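(* There exist a separable complex Hilbert space $H$, linear operators $A$ and $B$ on $H$ and a family $\Phi=(\phi_j)_{j\in\mathbf{N}}$ in $H$ (with $\mathbf{N}=\{1,2,\dots\}$) such that: (1) $A$ is skew-adjoint, possibly unbounded, on its domain $D(A)$; (2) $\mathrm{i}A$ is positive; (3) $B$ is skew-symmetric and is bounded on $H$ (so that in particular there exist $a,b\in\mathbf{R}$ with $\|B\psi\|\le a\|A\psi\|+b\|\psi\|$ for every $\psi\in D(A)$); (4) $\Phi$ is a Hilbert basis of $H$ made of eigenvectors of $A$: for every $j\in\mathbf{N}$ there exists $\lambda_j\in\mathbf{R}$ such that $A\phi_j=-\mathrm{i}\lambda_j\phi_j$; and such that, for every real number $M\ge 0$, there exist $T_M\geq 0$ and a function $u_M:[0,T_M]\to\mathbf{R}$ with bounded variation satisfying $$\|A\,\Upsilon^{u_M}_{T_M}\phi_1\|\ \ge\ M\qquad\text{and}\qquad M\ \ge\ \frac{\|B\|}{4}\,TV_{[0,T_M]}(u_M).$$ Here $\Upsilon^{u}$ denotes the propagator of $\frac{\mathrm{d}\psi}{\mathrm{d}t}(t)=A\psi(t)+u(t)B\psi(t)$.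
   Context: $TV_{[0,T]}(u)$ denotes the total variation of $u$ on $[0,T]$, and $\|B\|$ is the operator norm of the bounded operator $B$ on $H$. Propagator: let $A$ be skew-adjoint with domain $D(A)$ and $B$ bounded and skew-symmetric on $H$. For a function $u:[0,T]\to\mathbf{R}$ with bounded variation, $t\mapsto\Upsilon^u_t$ denotes the (strongly) continuous mapping from $[0,T]$ to the unitary group $\mathbf{U}(H)$ of $H$, with $\Upsilon^u_0=\mathrm{Id}$, such that for every $\psi\in D(A)$ the map $t\mapsto\Upsilon^u_t\psi$ is differentiable almost everywhere and satisfies $\frac{\mathrm{d}}{\mathrm{d}t}\Upsilon^u_t\psi=A\Upsilon^u_t\psi+u(t)B\Upsilon^u_t\psi$ for almost every $t\in(0,T]$. For piecewise constant $u$, taking successive values $u_1,\dots,u_p$ on intervals of lengths $t_1,\dots,t_p$ covering $[0,T]$, one has $\Upsilon^u_T=e^{t_p(A+u_pB)}\cdots e^{t_1(A+u_1B)}$. For general $u$ of bounded variation, $\Upsilon^u_t\psi$ is the limit of $\Upsilon^{u_n}_t\psi$ for any sequence of piecewise constant $u_n$ converging pointwise to $u$ with $|u_n|\le|u|$ and $TV_{[0,T]}(u_n)\le TV_{[0,T]}(u)$. The operators $\Upsilon^u_t$ map $D(A)$ into $D(A)$. *)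

theory Defs
  imports "HOL-Analysis.Analysis" "HOL-Library.Function_Algebras"
begin

section \<open>Complex Hilbert spaces\<close>

text \<open>
  A type-class Hilbert space could not be quantified existentially, so the space is a record on an
  ambient additive group: a carrier, a complex scalar multiplication and an inner product
  (linear in its first argument), the latter being relevant on the carrier only.
  Every separable complex Hilbert space is isometrically isomorphic to one of these on the ambient
  type \<open>nat \<Rightarrow> complex\<close> (with pointwise addition).
\<close>

record 'a cspace =
  hcarrier :: "'a set"
  hscale :: "complex \<Rightarrow> 'a \<Rightarrow> 'a"
  hinner :: "'a \<Rightarrow> 'a \<Rightarrow> complex"

definition hnorm :: "('a::ab_group_add) cspace \<Rightarrow> 'a \<Rightarrow> real" where
  "hnorm H x = sqrt (Re (hinner H x x))"

definition hdist :: "('a::ab_group_add) cspace \<Rightarrow> 'a \<Rightarrow> 'a \<Rightarrow> real" where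
  "hdist H x y = (if x \<in> hcarrier H \<and> y \<in> hcarrier H then hnorm H (x - y) else 0)"
  \<comment> \<open>the value \<open>0\<close> off the carrier makes it nonnegative and symmetric on the whole type,
    as \<open>Metric_space\<close> requires\<close>

abbreviation htopology :: "('a::ab_group_add) cspace \<Rightarrow> 'a topology" where
  "htopology H \<equiv> Metric_space.mtopology (hcarrier H) (hdist H)"

definition complex_hilbert_space :: "('a::ab_group_add) cspace \<Rightarrow> bool" where
  "complex_hilbert_space H \<longleftrightarrow>
     vector_space (hscale H) \<and> module.subspace (hscale H) (hcarrier H) \<and>
     (\<forall>x\<in>hcarrier H. \<forall>y\<in>hcarrier H. \<forall>z\<in>hcarrier H.
        hinner H (x + y) z = hinner H x z + hinner H y z) \<and>
     (\<forall>c. \<forall>x\<in>hcarrier H. \<forall>y\<in>hcarrier H. hinner H (hscale H c x) y = c * hinner H x y) \<and>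
     (\<forall>x\<in>hcarrier H. \<forall>y\<in>hcarrier H. hinner H y x = cnj (hinner H x y)) \<and>
     (\<forall>x\<in>hcarrier H. x \<noteq> 0 \<longrightarrow> 0 < Re (hinner H x x)) \<and>
     Metric_space.mcomplete (hcarrier H) (hdist H)"

definition separable_hilbert_space :: "('a::ab_group_add) cspace \<Rightarrow> bool" where
  "separable_hilbert_space H \<longleftrightarrow> complex_hilbert_space H \<and> separable_space (htopology H)"

definition hilbert_basis :: "('a::ab_group_add) cspace \<Rightarrow> 'i set \<Rightarrow> ('i \<Rightarrow> 'a) \<Rightarrow> bool" where
  "hilbert_basis H J \<phi> \<longleftrightarrow>
     \<phi> ` J \<subseteq> hcarrier H \<and>
     (\<forall>j\<in>J. \<forall>k\<in>J. hinner H (\<phi> j) (\<phi> k) = (if j = k then 1 else 0)) \<and>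
     htopology H closure_of (module.span (hscale H) (\<phi> ` J)) = hcarrier H"


section \<open>Operators\<close>

text \<open>
  An operator with domain \<open>D\<close> is a total function of which only the values on \<open>D\<close> matter.
\<close>

definition linear_operator :: "('a::ab_group_add) cspace \<Rightarrow> 'a set \<Rightarrow> ('a \<Rightarrow> 'a) \<Rightarrow> bool" where
  "linear_operator H D F \<longleftrightarrow>
     D \<subseteq> hcarrier H \<and> module.subspace (hscale H) D \<and> F ` D \<subseteq> hcarrier H \<and>
     (\<forall>x\<in>D. \<forall>y\<in>D. F (x + y) = F x + F y) \<and>
     (\<forall>c. \<forall>x\<in>D. F (hscale H c x) = hscale H c (F x))"

definition adjoint_graph ::
    "('a::ab_group_add) cspace \<Rightarrow> 'a set \<Rightarrow> ('a \<Rightarrow> 'a) \<Rightarrow> ('a \<times> 'a) set" where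
  "adjoint_graph H D F =
     {(\<psi>, \<eta>). \<psi> \<in> hcarrier H \<and> \<eta> \<in> hcarrier H \<and> (\<forall>\<xi>\<in>D. hinner H (F \<xi>) \<psi> = hinner H \<xi> \<eta>)}"

definition skew_adjoint :: "('a::ab_group_add) cspace \<Rightarrow> 'a set \<Rightarrow> ('a \<Rightarrow> 'a) \<Rightarrow> bool" where
  "skew_adjoint H D F \<longleftrightarrow>
     linear_operator H D F \<and> htopology H closure_of D = hcarrier H \<and>
     adjoint_graph H D F = (\<lambda>\<psi>. (\<psi>, - F \<psi>)) ` D"

definition positive_operator :: "('a::ab_group_add) cspace \<Rightarrow> 'a set \<Rightarrow> ('a \<Rightarrow> 'a) \<Rightarrow> bool" where
  "positive_operator H D F \<longleftrightarrow>
     (\<forall>\<psi>\<in>D. hinner H (F \<psi>) \<psi> \<in> \<real> \<and> 0 \<le> Re (hinner H (F \<psi>) \<psi>))"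

definition skew_symmetric :: "('a::ab_group_add) cspace \<Rightarrow> 'a set \<Rightarrow> ('a \<Rightarrow> 'a) \<Rightarrow> bool" where
  "skew_symmetric H D F \<longleftrightarrow>
     linear_operator H D F \<and> (\<forall>\<psi>\<in>D. \<forall>\<xi>\<in>D. hinner H (F \<psi>) \<xi> = - hinner H \<psi> (F \<xi>))"

definition bounded_operator :: "('a::ab_group_add) cspace \<Rightarrow> ('a \<Rightarrow> 'a) \<Rightarrow> bool" where
  "bounded_operator H F \<longleftrightarrow>
     linear_operator H (hcarrier H) F \<and> (\<exists>K. \<forall>\<psi>\<in>hcarrier H. hnorm H (F \<psi>) \<le> K * hnorm H \<psi>)"

definition operator_norm :: "('a::ab_group_add) cspace \<Rightarrow> ('a \<Rightarrow> 'a) \<Rightarrow> real" where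
  "operator_norm H F = (SUP \<psi> \<in> {\<psi> \<in> hcarrier H. hnorm H \<psi> \<le> 1}. hnorm H (F \<psi>))"

definition unitary_operator :: "('a::ab_group_add) cspace \<Rightarrow> ('a \<Rightarrow> 'a) \<Rightarrow> bool" where
  "unitary_operator H U \<longleftrightarrow>
     linear_operator H (hcarrier H) U \<and> U ` hcarrier H = hcarrier H \<and>
     (\<forall>\<psi>\<in>hcarrier H. \<forall>\<xi>\<in>hcarrier H. hinner H (U \<psi>) (U \<xi>) = hinner H \<psi> \<xi>)"


section \<open>Derivatives and unitary groups\<close>

definition has_hderivative ::
    "('a::ab_group_add) cspace \<Rightarrow> (real \<Rightarrow> 'a) \<Rightarrow> 'a \<Rightarrow> real \<Rightarrow> real set \<Rightarrow> bool" where
  "has_hderivative H f f' t S \<longleftrightarrow>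
     limitin (htopology H) (\<lambda>s. hscale H (complex_of_real (1 / (s - t))) (f s - f t)) f'
       (at t within S)"

text \<open>
  \<open>U t\<close> is \<open>exp (t F)\<close> in the sense of Stone's theorem: a strongly continuous one-parameter unitary
  group whose infinitesimal generator is exactly \<open>F\<close> with domain \<open>D\<close>.
\<close>

definition unitary_group_generated_by ::
    "('a::ab_group_add) cspace \<Rightarrow> 'a set \<Rightarrow> ('a \<Rightarrow> 'a) \<Rightarrow> (real \<Rightarrow> 'a \<Rightarrow> 'a) \<Rightarrow> bool" where
  "unitary_group_generated_by H D F U \<longleftrightarrow>
     (\<forall>t. unitary_operator H (U t)) \<and>
     (\<forall>\<psi>\<in>hcarrier H. U 0 \<psi> = \<psi> \<and> (\<forall>s t. U (s + t) \<psi> = U s (U t \<psi>)) \<and>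
        continuous_map euclideanreal (htopology H) (\<lambda>t. U t \<psi>)) \<and>
     (\<forall>\<psi>\<in>hcarrier H. \<forall>\<eta>.
        has_hderivative H (\<lambda>t. U t \<psi>) \<eta> 0 UNIV \<longleftrightarrow> \<psi> \<in> D \<and> \<eta> = F \<psi>)"


section \<open>Bounded variation and piecewise constant functions\<close>

definition variation_sums :: "real \<Rightarrow> (real \<Rightarrow> real) \<Rightarrow> real set" where
  "variation_sums T u =
     {(\<Sum>i<n. \<bar>u (s (Suc i)) - u (s i)\<bar>) | n s.
        (\<forall>i\<le>n. s i \<in> {0..T}) \<and> (\<forall>i<n. s i \<le> s (Suc i))}"

definition bounded_variation :: "real \<Rightarrow> (real \<Rightarrow> real) \<Rightarrow> bool" where
  "bounded_variation T u \<longleftrightarrow> bdd_above (variation_sums T u)"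

definition total_variation :: "real \<Rightarrow> (real \<Rightarrow> real) \<Rightarrow> real" where
  "total_variation T u = Sup (variation_sums T u)"

text \<open>
  \<open>pieces v a ps b\<close>: on \<open>[a, b]\<close>, \<open>v\<close> takes successively the values \<open>c\<close> on intervals of length \<open>l\<close>,
  for \<open>(l, c)\<close> in \<open>ps\<close>. The values at the finitely many end points are arbitrary.
\<close>

fun pieces :: "(real \<Rightarrow> real) \<Rightarrow> real \<Rightarrow> (real \<times> real) list \<Rightarrow> real \<Rightarrow> bool" where
  "pieces v a [] b \<longleftrightarrow> a = b"
| "pieces v a ((l, c) # ps) b \<longleftrightarrow> 0 \<le> l \<and> (\<forall>s\<in>{a<..<a + l}. v s = c) \<and> pieces v (a + l) ps b"

definition piecewise_constant :: "real \<Rightarrow> (real \<Rightarrow> real) \<Rightarrow> bool" where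
  "piecewise_constant T v \<longleftrightarrow> (\<exists>ps. pieces v 0 ps T)"

text \<open>
  With \<open>E c t = exp (t (A + c B))\<close>, this is
  \<open>exp (t\<^sub>p (A + u\<^sub>p B)) \<dots> exp (t\<^sub>1 (A + u\<^sub>1 B))\<close> for \<open>ps = [(t\<^sub>1, u\<^sub>1), \<dots>, (t\<^sub>p, u\<^sub>p)]\<close>.
\<close>

definition piecewise_propagator ::
    "(real \<Rightarrow> real \<Rightarrow> 'a \<Rightarrow> 'a) \<Rightarrow> (real \<times> real) list \<Rightarrow> 'a \<Rightarrow> 'a" where
  "piecewise_propagator E ps = fold (\<lambda>(l, c). E c l) ps"


section \<open>The propagator\<close>

text \<open>
  The equation almost everywhere does not determine \<open>\<Upsilon>\<close>: in dimension one, multiplying a solution by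
  \<open>exp (\<i> c(t))\<close> with \<open>c\<close> the Cantor function gives another one. The last clause, the approximation by
  propagators of piecewise constant functions, does determine \<open>\<Upsilon> t\<close> on the Hilbert space for every
  \<open>t\<close> in \<open>[0, T]\<close> (for piecewise constant \<open>u\<close>, take \<open>v n = u\<close>).
\<close>

definition is_propagator ::
    "('a::ab_group_add) cspace \<Rightarrow> 'a set \<Rightarrow> ('a \<Rightarrow> 'a) \<Rightarrow> ('a \<Rightarrow> 'a) \<Rightarrow> real \<Rightarrow> (real \<Rightarrow> real) \<Rightarrow>
     (real \<Rightarrow> 'a \<Rightarrow> 'a) \<Rightarrow> bool" where
  "is_propagator H D A B T u \<Upsilon> \<longleftrightarrow>
     (\<forall>t\<in>{0..T}. unitary_operator H (\<Upsilon> t)) \<and>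
     (\<forall>\<psi>\<in>hcarrier H. \<Upsilon> 0 \<psi> = \<psi> \<and>
        continuous_map (top_of_set {0..T}) (htopology H) (\<lambda>t. \<Upsilon> t \<psi>)) \<and>
     (\<forall>t\<in>{0..T}. \<Upsilon> t ` D \<subseteq> D) \<and>
     (\<forall>\<psi>\<in>D. AE t in lebesgue_on {0<..T}.
        has_hderivative H (\<lambda>s. \<Upsilon> s \<psi>)
          (A (\<Upsilon> t \<psi>) + hscale H (complex_of_real (u t)) (B (\<Upsilon> t \<psi>))) t {0..T}) \<and>
     (\<exists>E. (\<forall>c. unitary_group_generated_by H D
                 (\<lambda>\<psi>. A \<psi> + hscale H (complex_of_real c) (B \<psi>)) (E c)) \<and>
        (\<forall>v. (\<forall>n. piecewise_constant T (v n)) \<and>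
             (\<forall>s\<in>{0..T}. (\<lambda>n. v n s) \<longlonglongrightarrow> u s) \<and>
             (\<forall>n. \<forall>s\<in>{0..T}. \<bar>v n s\<bar> \<le> \<bar>u s\<bar>) \<and>
             (\<forall>n. total_variation T (v n) \<le> total_variation T u) \<longrightarrow>
           (\<forall>t\<in>{0..T}. \<forall>ps. (\<forall>n. pieces (v n) 0 (ps n) t) \<longrightarrow>
              (\<forall>\<psi>\<in>hcarrier H.
                 limitin (htopology H) (\<lambda>n. piecewise_propagator E (ps n) \<psi>) (\<Upsilon> t \<psi>)
                   sequentially))))"

end

theory Submission
  imports Defs
begin

text \<open>
  A constant control has total variation \<open>0\<close>, however large its value. The condition on the total
  variation is therefore free for constant controls, and it remains to find \<open>A\<close> and \<open>B\<close> for which the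
  states \<open>exp (t (A + c B)) \<phi>\<^sub>1\<close>, with \<open>c > 0\<close> and \<open>t \<ge> 0\<close>, have unbounded energy \<open>\<parallel>A \<psi>\<parallel>\<close>.

  A control \<open>c\<close> that acts for the time \<open>s / c\<close> approaches an impulse as \<open>c \<rightarrow> \<infinity>\<close>: the free evolution
  has no time to act, and the state tends to \<open>exp (s B) \<phi>\<^sub>1\<close>. If all energies were bounded, then this
  limit would lie in the domain of \<open>A\<close>, because \<open>A\<close> is closed. So any bounded skew-symmetric \<open>B\<close> whose
  exponential moves \<open>\<phi>\<^sub>1\<close> out of the domain is an example. On the space of square summable sequences,
  take \<open>A = diag (- \<i> 2 ^ j)\<close> and \<open>B = - \<i> \<langle>\<cdot>, v\<rangle> v\<close> with the unit vector \<open>v\<close> whose coordinates are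
  \<open>2 powr (- (j + 1) / 2)\<close>. Then \<open>exp (\<pi> B) \<phi>\<^sub>1 = \<phi>\<^sub>1 - 2 \<langle>\<phi>\<^sub>1, v\<rangle> v\<close>, and \<open>v\<close> is not in the domain. The
  limit argument is made quantitative in \<open>flow_near_kick\<close> and concluded in
  \<open>energy_bound_transfers_to_kick\<close>. Coordinates are numbered from \<open>0\<close>, so \<open>\<phi>\<^sub>n\<close> is the unit vector
  number \<open>n - 1\<close>.

  The larger part of the work is to show that \<open>exp (t (A + c B))\<close> exists and is the propagator of the
  constant control. In the interaction picture the perturbed equation has bounded, strongly continuous
  coefficients, so \<open>linear_ode_solution\<close> solves it; skewness makes the solutions unique and the flow
  isometric; and a bounded perturbation leaves the domain of the generator unchanged, which is
  \<open>flow_derivative_iff\<close>. The approximation clause in the definition of the propagator concerns only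
  constant functions, since a piecewise constant function with total variation \<open>0\<close> is constant; what
  remains is the continuity of the flow in \<open>c\<close>. This is \<open>is_propagator_const\<close>.
\<close>

section \<open>Linear differential equations with bounded coefficients\<close>

lemma antiderivative_on_line:
  fixes f :: "real \<Rightarrow> 'a::banach"
  assumes f: "continuous_on UNIV f"
  obtains F where "F 0 = 0" "\<And>t. (F has_vector_derivative f t) (at t)"
proof -
  let ?F = "\<lambda>t. if 0 \<le> t then integral {0..t} f else - integral {t..0} f"
  have "(?F has_vector_derivative f t) (at t)" for t
  proof -
    define R where "R = \<bar>t\<bar> + 1"
    have int: "f integrable_on {a..b}" for a b
      using f by (intro integrable_continuous_real continuous_on_subset[OF f]) auto
    have eq: "integral {-R..s} f - integral {-R..0} f = ?F s" if "s \<in> {-R<..<R}" for s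
    proof (cases "0 \<le> s")
      case True
      then have "integral {-R..0} f + integral {0..s} f = integral {-R..s} f"
        using int by (intro Henstock_Kurzweil_Integration.integral_combine) (auto simp: R_def)
      then show ?thesis using True by (simp add: algebra_simps)
    next
      case False
      then have "integral {-R..s} f + integral {s..0} f = integral {-R..0} f"
        using int that by (intro Henstock_Kurzweil_Integration.integral_combine) auto
      then show ?thesis using False by (simp add: algebra_simps)
    qed
    have "((\<lambda>s. integral {-R..s} f) has_vector_derivative f t) (at t within {-R..R})"
      by (rule integral_has_vector_derivative) (auto simp: R_def intro: continuous_on_subset[OF f])
    then have "((\<lambda>s. integral {-R..s} f) has_vector_derivative f t) (at t within {-R<..<R})"
      by (rule has_vector_derivative_within_subset) auto
    then have "((\<lambda>s. integral {-R..s} f) has_vector_derivative f t) (at t)"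
      by (subst (asm) has_vector_derivative_within_open) (auto simp: R_def)
    then have "((\<lambda>s. integral {-R..s} f - integral {-R..0} f) has_vector_derivative f t) (at t)"
      by (auto intro!: derivative_eq_intros)
    then show "(?F has_vector_derivative f t) (at t)"
      by (rule has_vector_derivative_transform_within_open[where S = "{-R<..<R}"])
         (use eq in \<open>auto simp: R_def\<close>)
  qed
  then show thesis using that[of ?F] by simp
qed

text \<open>
  The exponential weight absorbs integration: integrating \<open>exp (k \<bar>t\<bar>)\<close> gains the factor \<open>1 / k\<close>.
  This is what turns the Picard operator below into a contraction on the whole line.
\<close>

lemma norm_le_exp_if_derivative_le_exp:
  fixes F :: "real \<Rightarrow> 'a::real_normed_vector"
  assumes F0: "F 0 = 0" and F: "\<And>t. (F has_vector_derivative f t) (at t)"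
    and le: "\<And>t. norm (f t) \<le> C * exp (k * \<bar>t\<bar>)" and k: "k > 0" and C: "C \<ge> 0"
  shows "norm (F t) \<le> C / k * exp (k * \<bar>t\<bar>)"
proof -
  have pos: "norm (G t) \<le> C / k * exp (k * t)"
    if G0: "G 0 = 0" and G: "\<And>t. (G has_vector_derivative g t) (at t)"
      and gle: "\<And>t. norm (g t) \<le> C * exp (k * \<bar>t\<bar>)" and t: "t > 0"
    for G g :: "real \<Rightarrow> 'a" and t
  proof -
    have "norm (G t - G 0) \<le> C / k * exp (k * t) - C / k * exp (k * 0)"
    proof (rule differentiable_bound_general[OF t, where f' = g and \<phi>' = "\<lambda>t. C * exp (k * t)"])
      show "continuous_on {0..t} G"
        using G by (meson continuous_at_imp_continuous_on has_vector_derivative_continuous)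
      show "continuous_on {0..t} (\<lambda>t. C / k * exp (k * t))"
        by (intro continuous_intros)
      show "((\<lambda>t. C / k * exp (k * t)) has_vector_derivative C * exp (k * s)) (at s)" for s
        using k unfolding has_real_derivative_iff_has_vector_derivative[symmetric]
        by (auto intro!: derivative_eq_intros)
      show "norm (g s) \<le> C * exp (k * s)" if "0 < s" for s
        using gle[of s] that by simp
    qed (use G in auto)
    moreover have "C / k \<ge> 0" using k C by simp
    ultimately show ?thesis using G0 by simp
  qed
  consider "t > 0" | "t = 0" | "t < 0" by linarith
  then show ?thesis
  proof cases
    case 1
    then show ?thesis using pos[OF F0 F le] by simp
  next
    case 2
    then show ?thesis using F0 k C by simp
  next
    case 3
    have "((\<lambda>s. F (- s)) has_vector_derivative - f (- s)) (at s)" for s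
    proof -
      have "((F \<circ> uminus) has_vector_derivative (-1) *\<^sub>R f (- s)) (at s)"
        by (rule vector_diff_chain_at) (auto intro!: derivative_eq_intros F)
      then show ?thesis by (simp add: o_def)
    qed
    then show ?thesis
      using pos[of "\<lambda>s. F (- s)" "\<lambda>s. - f (- s)" "- t"] F0 le 3
      by (metis abs_minus_cancel abs_of_neg minus_minus neg_0_less_iff_less norm_minus_cancel
          neg_equal_0_iff_equal)
  qed
qed

text \<open>
  Picard iteration on the whole line at once, for an operator family that is only strongly
  continuous. With \<open>w(t) = exp (k \<bar>t\<bar>) f(t)\<close>, solutions of the integral equation correspond to fixed
  points of an operator on bounded continuous functions \<open>f\<close> (Bielecki's weighted norm), and for
  \<open>k \<ge> 2 K\<close> this operator has Lipschitz constant \<open>1 / 2\<close>.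
\<close>

theorem linear_ode_solution:
  fixes L :: "real \<Rightarrow> 'a::banach \<Rightarrow> 'a"
  assumes lin: "\<And>t. linear (L t)" and le: "\<And>t x. norm (L t x) \<le> K * norm x"
    and cont: "\<And>x. continuous_on UNIV (\<lambda>t. L t x)"
  obtains w where "w 0 = x" "\<And>t. (w has_vector_derivative L t (w t)) (at t)"
proof -
  define k where "k = max 1 (2 * K)"
  have k: "k > 0" "K \<le> k / 2" by (auto simp: k_def)
  have leK: "norm (L t x) \<le> k / 2 * norm x" for t x
    by (rule order_trans[OF le mult_right_mono]) (use k in auto)
  have Lcont: "continuous_on UNIV (\<lambda>t. L t (g t))" if g: "continuous_on UNIV g" for g
  proof -
    have "((\<lambda>s. L s (g s)) \<longlongrightarrow> L t (g t)) (at t)" for t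
    proof -
      have "((\<lambda>s. g s - g t) \<longlongrightarrow> 0) (at t)"
        using g by (metis LIM_zero UNIV_I continuous_on_def)
      then have "((\<lambda>s. k / 2 * norm (g s - g t)) \<longlongrightarrow> 0) (at t)"
        by (metis mult_zero_right norm_zero tendsto_mult_left tendsto_norm)
      then have "((\<lambda>s. L s (g s - g t)) \<longlongrightarrow> 0) (at t)"
        by (rule Lim_null_comparison[rotated]) (intro always_eventually allI leK)
      moreover have "((\<lambda>s. L s (g t)) \<longlongrightarrow> L t (g t)) (at t)"
        using cont by (metis UNIV_I continuous_on_def)
      ultimately have "((\<lambda>s. L s (g s - g t) + L s (g t)) \<longlongrightarrow> 0 + L t (g t)) (at t)"
        by (rule tendsto_add)
      then show ?thesis by (simp add: linear_diff[OF lin])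
    qed
    then show ?thesis by (simp add: continuous_on_def)
  qed
  \<comment> \<open>\<open>W f\<close> removes the weight from \<open>f\<close>, \<open>I f\<close> is the integral of \<open>L t (W f t)\<close> from \<open>0\<close>,
    and \<open>V f\<close> is the weighted right-hand side of the integral equation.\<close>
  define W where "W f t = exp (k * \<bar>t\<bar>) *\<^sub>R apply_bcontfun f t" for f :: "real \<Rightarrow>\<^sub>C 'a" and t
  define P where "P f F \<longleftrightarrow> F 0 = 0 \<and> (\<forall>t. (F has_vector_derivative L t (W f t)) (at t))" for f F
  define I where "I f = (SOME F. P f F)" for f
  have Wcont: "continuous_on UNIV (W f)" for f
    unfolding W_def by (intro continuous_intros) auto
  have PI: "P f (I f)" for f
    unfolding I_def
  proof (rule someI_ex[of "P f"])
    obtain F where "F 0 = 0" "\<And>t. (F has_vector_derivative L t (W f t)) (at t)"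
      using antiderivative_on_line[OF Lcont[OF Wcont[of f]]] by metis
    then show "\<exists>F. P f F" by (auto simp: P_def)
  qed
  have Icont: "continuous_on UNIV (I f)" for f
    using PI[of f] unfolding P_def
    by (meson continuous_at_imp_continuous_on has_vector_derivative_continuous)
  have Idiff: "norm (I f t - I g t) \<le> dist f g / 2 * exp (k * \<bar>t\<bar>)" for f g t
  proof -
    have "norm (I f t - I g t) \<le> (k / 2 * dist f g) / k * exp (k * \<bar>t\<bar>)"
    proof (rule norm_le_exp_if_derivative_le_exp)
      show "I f 0 - I g 0 = 0" using PI unfolding P_def by simp
      show "((\<lambda>t. I f t - I g t) has_vector_derivative L t (W f t) - L t (W g t)) (at t)" for t
        using PI unfolding P_def by (auto intro!: derivative_intros)
      show "norm (L t (W f t) - L t (W g t)) \<le> k / 2 * dist f g * exp (k * \<bar>t\<bar>)" for t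
      proof -
        have "norm (L t (W f t) - L t (W g t)) = norm (L t (W f t - W g t))"
          by (simp add: linear_diff[OF lin])
        also have "\<dots> \<le> k / 2 * norm (W f t - W g t)" by (rule leK)
        also have "W f t - W g t = exp (k * \<bar>t\<bar>) *\<^sub>R (f t - g t)"
          by (simp add: W_def scaleR_diff_right)
        also have "k / 2 * norm \<dots> \<le> k / 2 * (exp (k * \<bar>t\<bar>) * dist f g)"
          using k dist_bounded[of f t g] by (simp add: dist_norm mult_left_mono)
        finally show ?thesis by (simp add: mult_ac)
      qed
    qed (use k in auto)
    then show ?thesis using k by simp
  qed
  have I0: "I 0 t = 0" for t
  proof -
    have "norm (I 0 t) \<le> 0 / k * exp (k * \<bar>t\<bar>)"
    proof (rule norm_le_exp_if_derivative_le_exp)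
      show "(I 0 has_vector_derivative L t (W 0 t)) (at t)" for t
        using PI[of 0] by (simp add: P_def)
      show "norm (L t (W 0 t)) \<le> 0 * exp (k * \<bar>t\<bar>)" for t
        using leK[of t "W 0 t"] by (simp add: W_def)
    qed (use k PI[of 0] in \<open>auto simp: P_def\<close>)
    then show ?thesis by simp
  qed
  define V where "V f t = exp (- (k * \<bar>t\<bar>)) *\<^sub>R (x + I f t)" for f t
  have "V f \<in> bcontfun" for f
  proof (rule bcontfun_normI)
    show "continuous_on UNIV (V f)" unfolding V_def by (intro continuous_intros Icont)
    show "norm (V f t) \<le> norm x + norm f / 2" for t
    proof -
      have "norm (V f t) = exp (- (k * \<bar>t\<bar>)) * norm (x + I f t)"
        by (simp add: V_def)
      also have "\<dots> \<le> exp (- (k * \<bar>t\<bar>)) * (norm x + norm f / 2 * exp (k * \<bar>t\<bar>))"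
        using Idiff[of f t 0] by (intro mult_left_mono norm_triangle_le) (auto simp: I0)
      also have "\<dots> = exp (- (k * \<bar>t\<bar>)) * norm x + norm f / 2"
        by (simp add: distrib_left exp_minus)
      also have "\<dots> \<le> 1 * norm x + norm f / 2"
        using k by (intro add_mono mult_right_mono) auto
      finally show ?thesis by simp
    qed
  qed
  then have V: "apply_bcontfun (Bcontfun (V f)) = V f" for f
    by (simp add: Bcontfun_inverse)
  have "\<exists>!f\<in>UNIV. Bcontfun (V f) = f"
  proof (rule Banach_fix)
    show "dist (Bcontfun (V f)) (Bcontfun (V g)) \<le> 1 / 2 * dist f g" for f g
    proof (rule dist_bound)
      show "dist (Bcontfun (V f) t) (Bcontfun (V g) t) \<le> 1 / 2 * dist f g" for t
      proof -
        have "dist (Bcontfun (V f) t) (Bcontfun (V g) t)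
            = exp (- (k * \<bar>t\<bar>)) * norm (I f t - I g t)"
          unfolding V by (simp add: V_def dist_norm flip: scaleR_diff_right)
        also have "\<dots> \<le> exp (- (k * \<bar>t\<bar>)) * (dist f g / 2 * exp (k * \<bar>t\<bar>))"
          using Idiff by (intro mult_left_mono) auto
        also have "\<dots> = 1 / 2 * dist f g" by (simp add: exp_minus)
        finally show ?thesis .
      qed
    qed
  qed (auto simp: complete_UNIV)
  then obtain f where f: "Bcontfun (V f) = f" by auto
  have "W f t = x + I f t" for t
    unfolding W_def by (subst f[symmetric], unfold V) (simp add: V_def exp_minus)
  then have Wf: "W f = (\<lambda>t. x + I f t)" by auto
  show thesis
  proof
    show "W f 0 = x" using PI[of f] by (simp add: Wf P_def)
    show "(W f has_vector_derivative L t (W f t)) (at t)" for t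
    proof -
      have "((\<lambda>t. x + I f t) has_vector_derivative 0 + L t (W f t)) (at t)"
        using PI[of f] unfolding P_def by (intro derivative_intros) auto
      then show ?thesis by (simp only: Wf[symmetric] add_0_left)
    qed
  qed
qed

section \<open>Bounded skew perturbations of orthogonal groups\<close>

lemma has_vector_derivative_iff_difference_quotient:
  "(f has_vector_derivative y) (at t within T) \<longleftrightarrow>
   ((\<lambda>s. (1 / (s - t)) *\<^sub>R (f s - f t)) \<longlongrightarrow> y) (at t within T)"
proof -
  have "(f has_vector_derivative y) (at t within T) \<longleftrightarrow>
      ((\<lambda>s. (f s - f t - (s - t) *\<^sub>R y) /\<^sub>R norm (s - t)) \<longlongrightarrow> 0) (at t within T)"
    by (simp add: has_vector_derivative_def has_derivative_within bounded_linear_scaleR_left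
        diff_diff_eq divide_inverse)
  also have "\<dots> \<longleftrightarrow> ((\<lambda>s. norm ((f s - f t - (s - t) *\<^sub>R y) /\<^sub>R norm (s - t))) \<longlongrightarrow> 0) (at t within T)"
    by (simp only: tendsto_norm_zero_iff)
  also have "\<dots> \<longleftrightarrow> ((\<lambda>s. norm ((1 / (s - t)) *\<^sub>R (f s - f t) - y)) \<longlongrightarrow> 0) (at t within T)"
  proof (rule filterlim_cong[OF refl refl])
    have "norm ((f s - f t - (s - t) *\<^sub>R y) /\<^sub>R norm (s - t)) = norm ((1 / (s - t)) *\<^sub>R (f s - f t) - y)"
      if "s \<noteq> t" for s
    proof -
      have "(1 / (s - t)) *\<^sub>R (f s - f t) - y = (1 / (s - t)) *\<^sub>R (f s - f t - (s - t) *\<^sub>R y)"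
        using that by (simp add: scaleR_diff_right)
      then show ?thesis by (simp add: divide_inverse)
    qed
    then show "\<forall>\<^sub>F s in at t within T. norm ((f s - f t - (s - t) *\<^sub>R y) /\<^sub>R norm (s - t))
        = norm ((1 / (s - t)) *\<^sub>R (f s - f t) - y)"
      by (auto simp: eventually_at_filter)
  qed
  also have "\<dots> \<longleftrightarrow> ((\<lambda>s. (1 / (s - t)) *\<^sub>R (f s - f t)) \<longlongrightarrow> y) (at t within T)"
    by (simp only: tendsto_norm_zero_iff LIM_zero_iff)
  finally show ?thesis .
qed

lemma has_vector_derivative_at_0_iff:
  "(f has_vector_derivative y) (at (0::real)) \<longleftrightarrow> ((\<lambda>h. (f h - f 0) /\<^sub>R h) \<longlongrightarrow> y) (at 0)"
  using has_vector_derivative_iff_difference_quotient[of f y 0 UNIV] by (simp add: divide_inverse)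

lemma has_vector_derivative_shift_argument:
  assumes "(f has_vector_derivative y) (at (t + a))"
  shows "((\<lambda>s. f (s + a)) has_vector_derivative y) (at t)"
proof -
  have "((f \<circ> (\<lambda>s. s + a)) has_vector_derivative 1 *\<^sub>R y) (at t)"
    by (rule vector_diff_chain_at) (auto intro!: derivative_eq_intros assms)
  then show ?thesis by (simp add: o_def)
qed

text \<open>
  The unperturbed dynamics \<open>S\<close> is a strongly continuous orthogonal group, whose generator may be
  unbounded, and \<open>B\<close> is a bounded skew operator. The perturbed dynamics is built in the interaction
  picture: \<open>w(t) = S(-t) \<psi>(t)\<close> satisfies \<open>w' = c S(-t) B S(t) w\<close>, in which the unbounded generator no
  longer occurs. All operators here are real-linear; complex linearity is recovered from
  commutation with the complex scalars.
\<close>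

locale skew_perturbation =
  fixes S :: "real \<Rightarrow> 'a::{real_inner,banach} \<Rightarrow> 'a" and B :: "'a \<Rightarrow> 'a"
  assumes S_linear: "linear (S t)"
    and S_inner: "S t x \<bullet> S t y = x \<bullet> y"
    and S_0: "S 0 x = x"
    and S_add: "S (s + t) x = S s (S t x)"
    and S_continuous: "continuous_on UNIV (\<lambda>t. S t x)"
    and B_bounded_linear: "bounded_linear B"
    and B_skew: "B x \<bullet> y = - (x \<bullet> B y)"
begin

lemma norm_S: "norm (S t x) = norm x"
  by (simp add: norm_eq_sqrt_inner S_inner)

lemma S_minus: "S t (S (- t) x) = x"
  by (simp add: S_add[symmetric] S_0)

lemma inner_S_minus: "S (- t) x \<bullet> y = x \<bullet> S t y"
  using S_inner[of t "S (- t) x" y] by (simp add: S_minus)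

text \<open>
  Strong continuity is continuity in the time for a fixed vector; since the group is isometric, the
  vector may move as well.
\<close>

lemma tendsto_S:
  assumes f: "(f \<longlongrightarrow> x) F" and h: "(h \<longlongrightarrow> t) F"
  shows "((\<lambda>s. S (h s) (f s)) \<longlongrightarrow> S t x) F"
proof -
  have "((\<lambda>s. S (h s) (f s - x)) \<longlongrightarrow> 0) F"
    using tendsto_norm_zero[OF LIM_zero[OF f]]
    by - (rule tendsto_norm_zero_cancel, simp add: norm_S)
  moreover have "((\<lambda>s. S (h s) x) \<longlongrightarrow> S t x) F"
    using S_continuous h by (rule continuous_on_tendsto_compose) auto
  ultimately have "((\<lambda>s. S (h s) (f s - x) + S (h s) x) \<longlongrightarrow> 0 + S t x) F"
    by (rule tendsto_add)
  then show ?thesis by (simp add: linear_diff[OF S_linear])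
qed

definition moving_B :: "real \<Rightarrow> 'a \<Rightarrow> 'a" where
  "moving_B t x = S (- t) (B (S t x))"

lemma linear_moving_B: "linear (moving_B t)"
proof -
  have "linear (S (- t) \<circ> (B \<circ> S t))"
    by (intro linear_compose S_linear bounded_linear.linear[OF B_bounded_linear])
  then show ?thesis unfolding moving_B_def o_def .
qed

lemma moving_B_skew: "moving_B t x \<bullet> y = - (x \<bullet> moving_B t y)"
  using inner_S_minus[of t "B (S t x)" y] inner_S_minus[of t "B (S t y)" x]
    B_skew[of "S t x" "S t y"]
  by (simp add: moving_B_def inner_commute)

lemma norm_moving_B: "norm (moving_B t x) \<le> onorm B * norm x"
  using onorm[OF B_bounded_linear, of "S t x"] by (simp add: moving_B_def norm_S)

lemma continuous_moving_B: "continuous_on UNIV (\<lambda>t. moving_B t x)"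
  unfolding continuous_on_def moving_B_def
  by (intro ballI tendsto_S bounded_linear.tendsto[OF B_bounded_linear] tendsto_intros)

definition solves :: "real \<Rightarrow> (real \<Rightarrow> 'a) \<Rightarrow> bool" where
  "solves c w \<longleftrightarrow> (\<forall>t. (w has_vector_derivative c *\<^sub>R moving_B t (w t)) (at t))"

text \<open>
  The derivative of the inner product vanishes because the generator is skew at every time. This
  one conservation law yields both uniqueness and isometry.
\<close>

lemma solves_inner:
  assumes "solves c u" "solves c v"
  shows "u t \<bullet> v t = u 0 \<bullet> v 0"
proof -
  have "((\<lambda>t. u t \<bullet> v t) has_real_derivative 0) (at t)" for t
  proof -
    have "((\<lambda>t. u t \<bullet> v t) has_vector_derivative
        u t \<bullet> (c *\<^sub>R moving_B t (v t)) + (c *\<^sub>R moving_B t (u t)) \<bullet> v t) (at t)"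
      using assms unfolding solves_def
      by (intro bounded_bilinear.has_vector_derivative[OF bounded_bilinear_inner]) auto
    then show ?thesis
      by (simp add: moving_B_skew has_real_derivative_iff_has_vector_derivative)
  qed
  then show ?thesis by (rule DERIV_isconst_all[rule_format])
qed

lemma solves_add: "solves c u \<Longrightarrow> solves c v \<Longrightarrow> solves c (\<lambda>t. u t + v t)"
  unfolding solves_def linear_add[OF linear_moving_B] scaleR_add_right
  by (blast intro: has_vector_derivative_add)

lemma solves_linear_image:
  assumes u: "solves c u" and J: "bounded_linear J" and comm: "\<And>t x. J (moving_B t x) = moving_B t (J x)"
  shows "solves c (\<lambda>t. J (u t))"
  unfolding solves_def
proof
  fix t
  have "((\<lambda>t. J (u t)) has_vector_derivative J (c *\<^sub>R moving_B t (u t))) (at t)"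
    using u unfolding solves_def by (intro bounded_linear.has_vector_derivative[OF J]) auto
  then show "((\<lambda>t. J (u t)) has_vector_derivative c *\<^sub>R moving_B t (J (u t))) (at t)"
    by (simp add: linear_scale[OF bounded_linear.linear[OF J]] comm)
qed

lemma solves_unique:
  assumes u: "solves c u" and v: "solves c v" and eq: "u 0 = v 0"
  shows "u t = v t"
proof -
  have "bounded_linear (\<lambda>x. - x :: 'a)"
    by (simp add: bounded_linear_minus)
  then have "solves c (\<lambda>t. - v t)"
    using v by (intro solves_linear_image[where J = uminus])
      (auto simp: linear_neg[OF linear_moving_B])
  then have "solves c (\<lambda>t. u t + - v t)" by (rule solves_add[OF u])
  from solves_inner[OF this this, of t] show ?thesis using eq by simp
qed

definition interaction :: "real \<Rightarrow> 'a \<Rightarrow> real \<Rightarrow> 'a" where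
  "interaction c x = (SOME w. w 0 = x \<and> solves c w)"

lemma interaction: "interaction c x 0 = x" "solves c (interaction c x)"
proof -
  have lin: "linear (\<lambda>x. c *\<^sub>R moving_B t x)" for t
    using linear_moving_B by (intro linear_compose_scale_right)
  have le: "norm (c *\<^sub>R moving_B t x) \<le> (\<bar>c\<bar> * onorm B) * norm x" for t x
    using norm_moving_B by (simp add: mult.assoc mult_left_mono)
  have cont: "continuous_on UNIV (\<lambda>t. c *\<^sub>R moving_B t x)" for x
    by (intro continuous_intros continuous_moving_B)
  obtain w where "w 0 = x" "\<And>t. (w has_vector_derivative c *\<^sub>R moving_B t (w t)) (at t)"
    using linear_ode_solution[of "\<lambda>t x. c *\<^sub>R moving_B t x", OF lin le cont] by blast
  then have "\<exists>w. w 0 = x \<and> solves c w" by (auto simp: solves_def)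
  from someI_ex[OF this] show "interaction c x 0 = x" "solves c (interaction c x)"
    unfolding interaction_def by auto
qed

lemma interaction_unique: "solves c w \<Longrightarrow> interaction c (w 0) t = w t"
  by (rule solves_unique[OF interaction(2)]) (simp_all add: interaction(1))

definition flow :: "real \<Rightarrow> real \<Rightarrow> 'a \<Rightarrow> 'a" where
  "flow c t x = S t (interaction c x t)"

lemma flow_0: "flow c 0 x = x"
  by (simp add: flow_def interaction S_0)

lemma flow_inner: "flow c t x \<bullet> flow c t y = x \<bullet> y"
  using solves_inner[OF interaction(2)[of c x] interaction(2)[of c y]]
  by (simp add: flow_def S_inner interaction(1))

lemma norm_flow: "norm (flow c t x) = norm x"
  by (simp add: norm_eq_sqrt_inner flow_inner)

lemma flow_commute:
  assumes J: "bounded_linear J" and JS: "\<And>t x. J (S t x) = S t (J x)" and JB: "\<And>x. J (B x) = B (J x)"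
  shows "J (flow c t x) = flow c t (J x)"
proof -
  have "solves c (\<lambda>t. J (interaction c x t))"
    using interaction(2) J by (rule solves_linear_image) (simp add: moving_B_def JS JB)
  from interaction_unique[OF this, of t] show ?thesis
    by (simp add: flow_def JS interaction(1))
qed

lemma flow_add_vector: "flow c t (x + y) = flow c t x + flow c t y"
  using interaction_unique[OF solves_add[OF interaction(2)[of c x] interaction(2)[of c y]], of t]
  by (simp add: flow_def linear_add[OF S_linear] interaction(1))

lemma linear_flow: "linear (flow c t)"
proof (rule linearI[OF flow_add_vector])
  fix r x
  have "r *\<^sub>R flow c t x = flow c t (r *\<^sub>R x)"
    by (rule flow_commute[OF bounded_linear_scaleR_right])
       (simp_all add: linear_scale[OF S_linear]
         linear_scale[OF bounded_linear.linear[OF B_bounded_linear]])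
  then show "flow c t (r *\<^sub>R x) = r *\<^sub>R flow c t x" by simp
qed

text \<open>
  Shifting a solution of the interaction picture in time by \<open>t\<close> and moving it by \<open>S t\<close> gives again a
  solution, so uniqueness identifies the two sides.
\<close>

lemma flow_add: "flow c (s + t) x = flow c s (flow c t x)"
proof -
  let ?w = "interaction c x"
  have "solves c (\<lambda>s. S t (?w (s + t)))"
    unfolding solves_def
  proof
    fix s
    have "((\<lambda>s. ?w (s + t)) has_vector_derivative c *\<^sub>R moving_B (s + t) (?w (s + t))) (at s)"
      using interaction(2)[of c x] unfolding solves_def
      by (intro has_vector_derivative_shift_argument) auto
    then have "((\<lambda>s. S t (?w (s + t))) has_vector_derivative
        S t (c *\<^sub>R moving_B (s + t) (?w (s + t)))) (at s)"
      by (rule bounded_linear.has_vector_derivative[rotated])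
         (auto intro!: bounded_linear_intro[where K = 1] simp: norm_S
           linear_add[OF S_linear] linear_scale[OF S_linear])
    moreover have "S t (moving_B (s + t) y) = moving_B s (S t y)" for y
    proof -
      have "S t (moving_B (s + t) y) = S (- s) (B (S (s + t) y))"
        by (simp add: moving_B_def S_add[symmetric])
      then show ?thesis by (simp add: moving_B_def S_add)
    qed
    ultimately show "((\<lambda>s. S t (?w (s + t))) has_vector_derivative
        c *\<^sub>R moving_B s (S t (?w (s + t)))) (at s)"
      by (simp add: linear_scale[OF S_linear])
  qed
  from interaction_unique[OF this, of s]
  have "interaction c (S t (?w t)) s = S t (?w (s + t))" by simp
  then show ?thesis by (simp add: flow_def S_add)
qed

lemma continuous_flow: "continuous_on UNIV (\<lambda>t. flow c t x)"
  unfolding continuous_on_def flow_def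
proof (intro ballI tendsto_S tendsto_intros)
  fix t
  have "continuous (at t) (interaction c x)"
    using interaction(2)[of c x] unfolding solves_def
    by (meson has_vector_derivative_continuous)
  then show "(interaction c x \<longlongrightarrow> interaction c x t) (at t)"
    by (simp add: isCont_def)
qed

text \<open>
  The interaction picture is differentiable for every initial vector, with derivative \<open>c B x\<close> at
  \<open>0\<close>. Hence the perturbed and the free trajectories are differentiable for the same vectors: a
  bounded perturbation does not change the domain of the generator.
\<close>

lemma flow_derivative_iff:
  "((\<lambda>t. flow c t x) has_vector_derivative y) (at 0) \<longleftrightarrow>
   ((\<lambda>t. S t x) has_vector_derivative y - c *\<^sub>R B x) (at 0)"
proof -
  let ?w = "interaction c x"
  have "(?w has_vector_derivative c *\<^sub>R moving_B 0 (?w 0)) (at 0)"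
    using interaction(2)[of c x] by (auto simp: solves_def)
  then have "((\<lambda>h. (?w h - x) /\<^sub>R h) \<longlongrightarrow> c *\<^sub>R B x) (at 0)"
    by (simp add: has_vector_derivative_at_0_iff interaction(1) moving_B_def S_0)
  then have "((\<lambda>h. S h ((?w h - x) /\<^sub>R h)) \<longlongrightarrow> S 0 (c *\<^sub>R B x)) (at 0)"
    by (intro tendsto_S tendsto_ident_at)
  then have B: "((\<lambda>h. S h ((?w h - x) /\<^sub>R h)) \<longlongrightarrow> c *\<^sub>R B x) (at 0)"
    by (simp add: S_0)
  have eq: "(flow c h x - flow c 0 x) /\<^sub>R h = S h ((?w h - x) /\<^sub>R h) + (S h x - S 0 x) /\<^sub>R h" for h
    by (simp add: flow_def S_0 interaction(1) linear_diff[OF S_linear] linear_scale[OF S_linear]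
        scaleR_diff_right)
  show ?thesis
    unfolding has_vector_derivative_at_0_iff eq
  proof
    assume "((\<lambda>h. S h ((?w h - x) /\<^sub>R h) + (S h x - S 0 x) /\<^sub>R h) \<longlongrightarrow> y) (at 0)"
    from tendsto_diff[OF this B] show "((\<lambda>h. (S h x - S 0 x) /\<^sub>R h) \<longlongrightarrow> y - c *\<^sub>R B x) (at 0)"
      by simp
  next
    assume "((\<lambda>h. (S h x - S 0 x) /\<^sub>R h) \<longlongrightarrow> y - c *\<^sub>R B x) (at 0)"
    from tendsto_add[OF B this]
    show "((\<lambda>h. S h ((?w h - x) /\<^sub>R h) + (S h x - S 0 x) /\<^sub>R h) \<longlongrightarrow> y) (at 0)"
      by simp
  qed
qed

lemma flow_derivative_shift:
  assumes "((\<lambda>t. flow c t x) has_vector_derivative y) (at 0)"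
  shows "((\<lambda>t. flow c t x) has_vector_derivative flow c t y) (at t)"
    and "((\<lambda>s. flow c s (flow c t x)) has_vector_derivative flow c t y) (at 0)"
proof -
  have bl: "bounded_linear (flow c t)"
    by (rule bounded_linear_intro[where K = 1])
       (auto simp: norm_flow linear_add[OF linear_flow] linear_scale[OF linear_flow])
  show *: "((\<lambda>s. flow c s (flow c t x)) has_vector_derivative flow c t y) (at 0)"
    using bounded_linear.has_vector_derivative[OF bl assms]
    by (simp add: flow_add[symmetric] add.commute)
  show "((\<lambda>t. flow c t x) has_vector_derivative flow c t y) (at t)"
    using has_vector_derivative_shift_argument[of "\<lambda>s. flow c s (flow c t x)" "flow c t y" t "- t"] *
    by (simp add: flow_add[symmetric])
qed

text \<open>
  In the derivative of the squared distance the skew part drops out, and only the difference of the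
  two coupling constants drives the trajectories apart.
\<close>

lemma norm_flow_diff_le:
  assumes t: "t \<ge> 0"
  shows "(norm (flow c t x - flow d t x))\<^sup>2 \<le> 4 * \<bar>c - d\<bar> * onorm B * (norm x)\<^sup>2 * t"
proof -
  let ?u = "interaction c x" and ?v = "interaction d x"
  let ?K = "4 * \<bar>c - d\<bar> * onorm B * (norm x)\<^sup>2"
  have nu: "norm (?u s) = norm x" and nv: "norm (?v s) = norm x" for s
    using solves_inner[OF interaction(2)[of c x] interaction(2)[of c x], of s]
      solves_inner[OF interaction(2)[of d x] interaction(2)[of d x], of s]
    by (simp_all add: norm_eq_sqrt_inner interaction(1))
  have der: "((\<lambda>s. (norm (?u s - ?v s))\<^sup>2) has_real_derivative
      2 * (c - d) * (moving_B s (?v s) \<bullet> (?u s - ?v s))) (at s)" for s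
  proof -
    let ?z = "?u s - ?v s"
    have "((\<lambda>s. ?u s - ?v s) has_vector_derivative c *\<^sub>R moving_B s (?u s) - d *\<^sub>R moving_B s (?v s)) (at s)"
      using interaction(2)[of c x] interaction(2)[of d x] unfolding solves_def
      by (intro derivative_intros) auto
    moreover have "c *\<^sub>R moving_B s (?u s) - d *\<^sub>R moving_B s (?v s)
        = c *\<^sub>R moving_B s ?z + (c - d) *\<^sub>R moving_B s (?v s)" (is "_ = ?z'")
      by (simp add: linear_diff[OF linear_moving_B] algebra_simps)
    ultimately have z: "((\<lambda>s. ?u s - ?v s) has_vector_derivative ?z') (at s)" by simp
    have "moving_B s ?z \<bullet> ?z = 0"
      using moving_B_skew[of s ?z ?z] by (simp add: inner_commute)
    then have "?z \<bullet> ?z' + ?z' \<bullet> ?z = 2 * (c - d) * (moving_B s (?v s) \<bullet> ?z)"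
      by (simp add: inner_add_left inner_add_right inner_commute)
    then show ?thesis
      using bounded_bilinear.has_vector_derivative[OF bounded_bilinear_inner z z]
      by (simp add: power2_norm_eq_inner has_real_derivative_iff_has_vector_derivative)
  qed
  have le: "2 * (c - d) * (moving_B s (?v s) \<bullet> (?u s - ?v s)) \<le> ?K" for s
  proof -
    have "2 * (c - d) * (moving_B s (?v s) \<bullet> (?u s - ?v s))
        \<le> 2 * \<bar>c - d\<bar> * \<bar>moving_B s (?v s) \<bullet> (?u s - ?v s)\<bar>"
      by (metis abs_ge_self abs_mult abs_numeral)
    also have "\<dots> \<le> 2 * \<bar>c - d\<bar> * (norm (moving_B s (?v s)) * norm (?u s - ?v s))"
      by (intro mult_left_mono Cauchy_Schwarz_ineq2) auto
    also have "\<dots> \<le> 2 * \<bar>c - d\<bar> * ((onorm B * norm x) * (2 * norm x))"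
    proof (intro mult_left_mono mult_mono)
      show "norm (moving_B s (?v s)) \<le> onorm B * norm x"
        using norm_moving_B[of s "?v s"] by (simp add: nv)
      show "norm (?u s - ?v s) \<le> 2 * norm x"
        using norm_triangle_ineq4[of "?u s" "?v s"] by (simp add: nu nv)
    qed (auto simp: onorm_pos_le[OF B_bounded_linear])
    finally show ?thesis by (simp add: power2_eq_square mult_ac)
  qed
  let ?f = "\<lambda>s. (norm (?u s - ?v s))\<^sup>2 - ?K * s"
  have "?f t \<le> ?f 0"
  proof (rule DERIV_nonpos_imp_nonincreasing[OF t])
    fix s assume "0 \<le> s" "s \<le> t"
    have "(?f has_real_derivative 2 * (c - d) * (moving_B s (?v s) \<bullet> (?u s - ?v s)) - ?K) (at s)"
      by (rule derivative_eq_intros der)+ auto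
    then show "\<exists>y. (?f has_real_derivative y) (at s) \<and> y \<le> 0"
      using le[of s] by (intro exI conjI) auto
  qed
  then show ?thesis
    by (simp add: flow_def interaction(1) norm_S linear_diff[OF S_linear, symmetric])
qed

lemma tendsto_flow_parameter:
  assumes d: "(d \<longlongrightarrow> c) F" and t: "t \<ge> 0"
  shows "((\<lambda>n. flow (d n) t x) \<longlongrightarrow> flow c t x) F"
proof -
  have "((\<lambda>n. 4 * \<bar>d n - c\<bar> * onorm B * (norm x)\<^sup>2 * t) \<longlongrightarrow> 4 * \<bar>c - c\<bar> * onorm B * (norm x)\<^sup>2 * t) F"
    by (intro tendsto_intros d)
  then have "((\<lambda>n. 4 * \<bar>d n - c\<bar> * onorm B * (norm x)\<^sup>2 * t) \<longlongrightarrow> 0) F" by simp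
  then have "((\<lambda>n. (norm (flow (d n) t x - flow c t x))\<^sup>2) \<longlongrightarrow> 0) F"
    by (rule Lim_null_comparison[rotated])
       (intro always_eventually allI, simp add: norm_flow_diff_le[OF t])
  then have "((\<lambda>n. norm (flow (d n) t x - flow c t x)) \<longlongrightarrow> 0) F"
    using tendsto_real_sqrt[of "\<lambda>n. (norm (flow (d n) t x - flow c t x))\<^sup>2" 0 F] by simp
  then show ?thesis by (rule LIM_zero_cancel[OF tendsto_norm_zero_cancel])
qed

end

section \<open>Square summable sequences\<close>

lemma square_summable_add:
  fixes f g :: "nat \<Rightarrow> complex"
  assumes "summable (\<lambda>j. (cmod (f j))\<^sup>2)" "summable (\<lambda>j. (cmod (g j))\<^sup>2)"
  shows "summable (\<lambda>j. (cmod (f j + g j))\<^sup>2)"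
proof (rule summable_comparison_test')
  show "summable (\<lambda>j. 2 * (cmod (f j))\<^sup>2 + 2 * (cmod (g j))\<^sup>2)"
    using assms by (intro summable_add summable_mult)
  show "norm ((cmod (f j + g j))\<^sup>2) \<le> 2 * (cmod (f j))\<^sup>2 + 2 * (cmod (g j))\<^sup>2" if "0 \<le> j" for j
  proof -
    have "(cmod (f j + g j))\<^sup>2 \<le> (cmod (f j) + cmod (g j))\<^sup>2"
      by (intro power_mono norm_triangle_ineq) auto
    also have "\<dots> \<le> 2 * (cmod (f j))\<^sup>2 + 2 * (cmod (g j))\<^sup>2"
      using sum_squares_bound[of "cmod (f j)" "cmod (g j)"] by (simp add: power2_sum)
    finally show ?thesis by simp
  qed
qed

lemma square_summable_mult:
  fixes f g :: "nat \<Rightarrow> complex"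
  assumes f: "summable (\<lambda>j. (cmod (f j))\<^sup>2)" and g: "\<And>j. cmod (g j) \<le> K"
  shows "summable (\<lambda>j. (cmod (g j * f j))\<^sup>2)"
proof (rule summable_comparison_test')
  show "summable (\<lambda>j. K\<^sup>2 * (cmod (f j))\<^sup>2)"
    using f by (rule summable_mult)
  show "norm ((cmod (g j * f j))\<^sup>2) \<le> K\<^sup>2 * (cmod (f j))\<^sup>2" if "0 \<le> j" for j
    using power_mono[OF g[of j], where n = 2] by (simp add: norm_mult power_mult_distrib mult_right_mono)
qed

lemma summable_mult_cnj:
  fixes f g :: "nat \<Rightarrow> complex"
  assumes "summable (\<lambda>j. (cmod (f j))\<^sup>2)" "summable (\<lambda>j. (cmod (g j))\<^sup>2)"
  shows "summable (\<lambda>j. f j * cnj (g j))"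
proof (rule summable_comparison_test')
  show "summable (\<lambda>j. (cmod (f j))\<^sup>2 + (cmod (g j))\<^sup>2)"
    using assms by (rule summable_add)
  show "norm (f j * cnj (g j)) \<le> (cmod (f j))\<^sup>2 + (cmod (g j))\<^sup>2" if "0 \<le> j" for j
    using sum_squares_bound[of "cmod (f j)" "cmod (g j)"]
      mult_nonneg_nonneg[OF norm_ge_zero[of "f j"] norm_ge_zero[of "g j"]]
    by (simp only: norm_mult complex_mod_cnj)
qed

typedef ell2 = "{f :: nat \<Rightarrow> complex. summable (\<lambda>j. (cmod (f j))\<^sup>2)}"
  morphisms coord ell2_of
  by (intro exI[where x = "\<lambda>_. 0"]) simp

lemma square_summable_coord: "summable (\<lambda>j. (cmod (coord x j))\<^sup>2)"
  using coord[of x] by simp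

lemma coord_ell2_of: "summable (\<lambda>j. (cmod (f j))\<^sup>2) \<Longrightarrow> coord (ell2_of f) = f"
  by (simp add: ell2_of_inverse)

lemma ell2_eqI: "(\<And>j. coord x j = coord y j) \<Longrightarrow> x = y"
  by (metis coord_inject ext)

definition cinner :: "ell2 \<Rightarrow> ell2 \<Rightarrow> complex" where
  "cinner x y = (\<Sum>j. coord x j * cnj (coord y j))"

lemma sums_cinner: "(\<lambda>j. coord x j * cnj (coord y j)) sums cinner x y"
  unfolding cinner_def
  by (intro summable_sums summable_mult_cnj square_summable_coord)

lemma sums_cinner_self: "(\<lambda>j. (cmod (coord x j))\<^sup>2) sums Re (cinner x x)"
  using sums_Re[OF sums_cinner[of x x]] by (simp add: complex_mult_cnj cmod_power2)

instantiation ell2 :: real_vector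
begin

definition "0 = ell2_of (\<lambda>_. 0)"
definition "x + y = ell2_of (\<lambda>j. coord x j + coord y j)" for x y :: ell2
definition "- x = ell2_of (\<lambda>j. - coord x j)" for x :: ell2
definition "x - y = ell2_of (\<lambda>j. coord x j - coord y j)" for x y :: ell2
definition "r *\<^sub>R x = ell2_of (\<lambda>j. r *\<^sub>R coord x j)" for x :: ell2

lemma coord_zero: "coord 0 j = 0"
  unfolding zero_ell2_def by (subst coord_ell2_of) auto

lemma coord_add: "coord (x + y) j = coord x j + coord y j"
  unfolding plus_ell2_def
  by (subst coord_ell2_of) (auto intro: square_summable_add square_summable_coord)

lemma coord_minus: "coord (- x) j = - coord x j"
  unfolding uminus_ell2_def by (subst coord_ell2_of) (auto intro: square_summable_coord)

lemma coord_diff: "coord (x - y) j = coord x j - coord y j"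
  unfolding minus_ell2_def
  using square_summable_add[OF square_summable_coord[of x] square_summable_coord[of "- y"]]
  by (subst coord_ell2_of) (auto simp: coord_minus)

lemma coord_scaleR: "coord (r *\<^sub>R x) j = r *\<^sub>R coord x j"
  unfolding scaleR_ell2_def
  using summable_mult[OF square_summable_coord[of x], of "r\<^sup>2"]
  by (subst coord_ell2_of) (auto simp: power_mult_distrib)

instance
  by standard (rule ell2_eqI, simp add: coord_zero coord_add coord_minus coord_diff coord_scaleR
      scaleR_add_right scaleR_add_left)+

end

lemmas coord_simps = coord_zero coord_add coord_minus coord_diff coord_scaleR

lemma cinner_commute: "cinner y x = cnj (cinner x y)"
proof (rule sums_unique2[OF sums_cinner])
  have "(\<lambda>j. cnj (coord x j * cnj (coord y j))) sums cnj (cinner x y)"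
    using sums_cinner by (simp only: sums_cnj)
  then show "(\<lambda>j. coord y j * cnj (coord x j)) sums cnj (cinner x y)"
    by (simp add: mult.commute)
qed

lemma cinner_add_left: "cinner (x + y) z = cinner x z + cinner y z"
proof (rule sums_unique2[OF sums_cinner])
  show "(\<lambda>j. coord (x + y) j * cnj (coord z j)) sums (cinner x z + cinner y z)"
    using sums_add[OF sums_cinner[of x z] sums_cinner[of y z]]
    by (simp add: coord_add distrib_right)
qed

instantiation ell2 :: real_inner
begin

definition "x \<bullet> y = Re (cinner x y)"
definition "norm x = sqrt (x \<bullet> x)" for x :: ell2
definition "dist x y = norm (x - y)" for x y :: ell2
definition "sgn x = x /\<^sub>R norm x" for x :: ell2
definition "(uniformity :: (ell2 \<times> ell2) filter) = (INF e\<in>{0 <..}. principal {(x, y). dist x y < e})"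
definition "open (U :: ell2 set) \<longleftrightarrow> (\<forall>x\<in>U. eventually (\<lambda>(x', y). x' = x \<longrightarrow> y \<in> U) uniformity)"

instance
proof
  fix x y z :: ell2 and r :: real
  show "x \<bullet> y = y \<bullet> x" by (simp add: inner_ell2_def cinner_commute[of y x])
  show "(x + y) \<bullet> z = x \<bullet> z + y \<bullet> z" by (simp add: inner_ell2_def cinner_add_left)
  have "(\<lambda>j. Re (coord (r *\<^sub>R x) j * cnj (coord y j))) sums (r * Re (cinner x y))"
    using sums_mult[OF sums_Re[OF sums_cinner[of x y]], of r]
    by (simp add: coord_scaleR algebra_simps)
  then show "r *\<^sub>R x \<bullet> y = r * (x \<bullet> y)"
    unfolding inner_ell2_def using sums_Re[OF sums_cinner] by (rule sums_unique2[rotated])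
  show "0 \<le> x \<bullet> x"
    unfolding inner_ell2_def by (rule sums_le[OF _ sums_zero sums_cinner_self]) simp
  show "x \<bullet> x = 0 \<longleftrightarrow> x = 0"
  proof
    assume "x \<bullet> x = 0"
    then have "(\<Sum>j. (cmod (coord x j))\<^sup>2) = 0"
      using sums_unique[OF sums_cinner_self[of x]] by (simp add: inner_ell2_def)
    then show "x = 0"
      using suminf_eq_zero_iff[OF square_summable_coord[of x]]
      by (intro ell2_eqI) (simp add: coord_zero)
  next
    assume "x = 0"
    then show "x \<bullet> x = 0"
      by (simp add: inner_ell2_def cinner_def coord_zero)
  qed
qed (simp_all add: norm_ell2_def dist_ell2_def sgn_ell2_def uniformity_ell2_def open_ell2_def)

end

lemma sums_norm_ell2: "(\<lambda>j. (cmod (coord x j))\<^sup>2) sums (norm x)\<^sup>2"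
  using sums_cinner_self[of x] by (simp add: power2_norm_eq_inner inner_ell2_def)

lemma norm_coord_le: "cmod (coord x j) \<le> norm x"
proof -
  have "(cmod (coord x j))\<^sup>2 \<le> (norm x)\<^sup>2"
    using sum_le_suminf[OF square_summable_coord[of x], of "{j}"] sums_unique[OF sums_norm_ell2[of x]]
    by simp
  then show ?thesis by (rule power2_le_imp_le) simp
qed

lemma bounded_linear_coord: "bounded_linear (\<lambda>x. coord x j)"
  by (rule bounded_linear_intro[where K = 1]) (auto simp: coord_simps norm_coord_le)

text \<open>
  Bounds on all partial sums, which survive coordinatewise limits, control the norm and even give
  membership; this is how limits of Cauchy sequences are found.
\<close>

lemma norm_ell2_leI:
  assumes "\<And>k. (\<Sum>j<k. (cmod (f j))\<^sup>2) \<le> e\<^sup>2" and e: "0 \<le> e"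
  shows "summable (\<lambda>j. (cmod (f j))\<^sup>2)" "norm (ell2_of f) \<le> e"
proof -
  show sum: "summable (\<lambda>j. (cmod (f j))\<^sup>2)"
    using assms(1) by (rule summableI_nonneg_bounded[rotated]) simp
  have "(norm (ell2_of f))\<^sup>2 \<le> e\<^sup>2"
    using sums_unique[OF sums_norm_ell2[of "ell2_of f"]] suminf_le_const[OF sum assms(1)]
    by (simp add: coord_ell2_of[OF sum])
  then show "norm (ell2_of f) \<le> e" using e by (rule power2_le_imp_le)
qed

instance ell2 :: complete_space
proof
  fix X :: "nat \<Rightarrow> ell2"
  assume X: "Cauchy X"
  have "convergent (\<lambda>n. coord (X n) j)" for j
    using bounded_linear.Cauchy[OF bounded_linear_coord X] by (rule Cauchy_convergent)
  then obtain l where l: "(\<lambda>n. coord (X n) j) \<longlonglongrightarrow> l j" for j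
    unfolding convergent_def by metis
  let ?d = "\<lambda>m j. coord (X m) j - l j"
  have bound: "\<exists>N. \<forall>m\<ge>N. \<forall>k. (\<Sum>j<k. (cmod (?d m j))\<^sup>2) \<le> e\<^sup>2" if e: "e > 0" for e
  proof -
    obtain N where N: "\<And>m n. m \<ge> N \<Longrightarrow> n \<ge> N \<Longrightarrow> norm (X m - X n) < e"
      using CauchyD[OF X e] by blast
    have "(\<Sum>j<k. (cmod (?d m j))\<^sup>2) \<le> e\<^sup>2" if m: "m \<ge> N" for m k
    proof (rule tendsto_upperbound)
      show "(\<lambda>n. \<Sum>j<k. (cmod (coord (X m) j - coord (X n) j))\<^sup>2)
          \<longlonglongrightarrow> (\<Sum>j<k. (cmod (?d m j))\<^sup>2)"
        by (intro tendsto_intros l)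
      have "(\<Sum>j<k. (cmod (coord (X m) j - coord (X n) j))\<^sup>2) \<le> e\<^sup>2" if "n \<ge> N" for n
      proof -
        have "(\<Sum>j<k. (cmod (coord (X m - X n) j))\<^sup>2) \<le> (norm (X m - X n))\<^sup>2"
          using sum_le_suminf[OF square_summable_coord[of "X m - X n"], of "{..<k}"]
            sums_unique[OF sums_norm_ell2[of "X m - X n"]] by simp
        also have "\<dots> \<le> e\<^sup>2"
          using N[OF m that] by (intro power_mono) auto
        finally show ?thesis by (simp add: coord_diff)
      qed
      then show "\<forall>\<^sub>F n in sequentially. (\<Sum>j<k. (cmod (coord (X m) j - coord (X n) j))\<^sup>2) \<le> e\<^sup>2"
        by (auto simp: eventually_sequentially)
    qed simp
    then show ?thesis by blast
  qed
  obtain N where N: "\<And>k. (\<Sum>j<k. (cmod (?d N j))\<^sup>2) \<le> 1\<^sup>2"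
    using bound[of 1] by auto
  let ?L = "X N - ell2_of (?d N)"
  have L: "coord ?L = l"
    using coord_ell2_of[OF norm_ell2_leI(1)[OF N]] by (auto simp: coord_diff)
  have "X \<longlonglongrightarrow> ?L"
  proof (rule LIMSEQ_I)
    fix e :: real assume e: "0 < e"
    then obtain M where M: "\<And>m k. m \<ge> M \<Longrightarrow> (\<Sum>j<k. (cmod (?d m j))\<^sup>2) \<le> (e / 2)\<^sup>2"
      using bound[of "e / 2"] by auto
    have "norm (X m - ?L) < e" if "m \<ge> M" for m
    proof -
      have "X m - ?L = ell2_of (?d m)"
        using coord_ell2_of[OF norm_ell2_leI(1)[OF M[OF that]]] L e
        by (intro ell2_eqI) (simp add: coord_diff)
      then show ?thesis using norm_ell2_leI(2)[OF M[OF that]] e by simp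
    qed
    then show "\<exists>no. \<forall>n\<ge>no. norm (X n - ?L) < e" by blast
  qed
  then show "convergent X" by (rule convergentI)
qed

instance ell2 :: banach ..

text \<open>
  The value is meaningful only if the products are square summable, which is automatic for bounded
  \<open>g\<close>.
\<close>

definition diag :: "(nat \<Rightarrow> complex) \<Rightarrow> ell2 \<Rightarrow> ell2" where
  "diag g x = ell2_of (\<lambda>j. g j * coord x j)"

lemma coord_diag:
  assumes "\<And>j. cmod (g j) \<le> K"
  shows "coord (diag g x) j = g j * coord x j"
  unfolding diag_def
  by (subst coord_ell2_of) (auto intro: square_summable_mult square_summable_coord assms)

text \<open>
  Uniformly bounded multipliers that converge coordinatewise converge strongly: this is dominated
  convergence for the series of squares.
\<close>

lemma tendsto_diag:
  assumes g: "\<And>s j. cmod (g s j) \<le> K" and h: "\<And>j. cmod (h j) \<le> K"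
    and lim: "\<And>j. ((\<lambda>s. g s j) \<longlongrightarrow> h j) F"
  shows "((\<lambda>s. diag (g s) x) \<longlongrightarrow> diag h x) F"
proof (cases "F = bot")
  case False
  have K: "cmod (g s j - h j) \<le> 2 * K" for s j
    using norm_triangle_ineq4[of "g s j" "h j"] g[of s j] h[of j] by linarith
  have sums: "(\<lambda>j. (cmod (g s j - h j))\<^sup>2 * (cmod (coord x j))\<^sup>2) sums (norm (diag (g s) x - diag h x))\<^sup>2" for s
    using sums_norm_ell2[of "diag (g s) x - diag h x"]
    by (simp add: coord_diff coord_diag[OF g] coord_diag[OF h] left_diff_distrib[symmetric]
        norm_mult power_mult_distrib)
  have "((\<lambda>s. \<Sum>j. (cmod (g s j - h j))\<^sup>2 * (cmod (coord x j))\<^sup>2) \<longlongrightarrow> (\<Sum>j::nat. 0)) F"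
  proof (rule tannerys_theorem[where M = "\<lambda>j. (2 * K)\<^sup>2 * (cmod (coord x j))\<^sup>2", THEN conjunct2, THEN conjunct2])
    show "((\<lambda>s. (cmod (g s j - h j))\<^sup>2 * (cmod (coord x j))\<^sup>2) \<longlongrightarrow> 0) F" for j
    proof -
      have "((\<lambda>s. (cmod (g s j - h j))\<^sup>2 * (cmod (coord x j))\<^sup>2)
          \<longlongrightarrow> (cmod (h j - h j))\<^sup>2 * (cmod (coord x j))\<^sup>2) F"
        by (intro tendsto_intros lim)
      then show ?thesis by simp
    qed
    show "\<forall>\<^sub>F (j, s) in sequentially \<times>\<^sub>F F. norm ((cmod (g s j - h j))\<^sup>2 * (cmod (coord x j))\<^sup>2)
        \<le> (2 * K)\<^sup>2 * (cmod (coord x j))\<^sup>2"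
      using power_mono[OF K, where n = 2]
      by (intro always_eventually) (auto simp: abs_mult intro!: mult_right_mono)
    show "summable (\<lambda>j. (2 * K)\<^sup>2 * (cmod (coord x j))\<^sup>2)"
      by (intro summable_mult square_summable_coord)
  qed (use False in auto)
  then have "((\<lambda>s. (norm (diag (g s) x - diag h x))\<^sup>2) \<longlongrightarrow> 0) F"
    by (simp add: sums_unique[OF sums, symmetric])
  from tendsto_real_sqrt[OF this] have "((\<lambda>s. norm (diag (g s) x - diag h x)) \<longlongrightarrow> 0) F"
    by simp
  then show ?thesis
    by (rule LIM_zero_cancel[OF tendsto_norm_zero_cancel])
qed simp

definition cscale :: "complex \<Rightarrow> ell2 \<Rightarrow> ell2" where
  "cscale c = diag (\<lambda>_. c)"

lemma coord_cscale: "coord (cscale c x) j = c * coord x j"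
  unfolding cscale_def by (rule coord_diag[OF order_refl])

lemma cscale_of_real: "cscale (complex_of_real r) x = r *\<^sub>R x"
  by (rule ell2_eqI) (simp add: coord_cscale coord_scaleR scaleR_conv_of_real)

lemma cinner_cscale_left: "cinner (cscale c x) y = c * cinner x y"
  using sums_unique2[OF sums_cinner[of "cscale c x" y]] sums_mult[OF sums_cinner[of x y], of c]
  by (simp add: coord_cscale mult.assoc)

lemma norm_cscale: "norm (cscale c x) = cmod c * norm x"
proof -
  have "(norm (cscale c x))\<^sup>2 = (cmod c * norm x)\<^sup>2"
    using sums_unique2[OF sums_norm_ell2[of "cscale c x"]] sums_mult[OF sums_norm_ell2[of x], of "(cmod c)\<^sup>2"]
    by (simp add: coord_cscale norm_mult power_mult_distrib)
  then show ?thesis by (simp add: power2_eq_iff_nonneg)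
qed

lemma bounded_linear_cscale: "bounded_linear (cscale c)"
  by (rule bounded_linear_intro[where K = "cmod c"])
     (auto simp: norm_cscale mult.commute coord_cscale coord_simps algebra_simps intro!: ell2_eqI)

lemma bounded_linear_cscale_left: "bounded_linear (\<lambda>k. cscale k v)"
  by (rule bounded_linear_intro[where K = "norm v"])
     (auto simp: norm_cscale coord_cscale coord_simps algebra_simps intro!: ell2_eqI)

text \<open>
  The complex inner product is determined by its real part, so an isometry for the real inner
  product that commutes with \<open>\<i>\<close> also preserves the complex one.
\<close>

lemma cinner_via_inner: "cinner x y = Complex (x \<bullet> y) (- (cscale \<i> x \<bullet> y))"
  by (simp add: complex_eq_iff inner_ell2_def cinner_cscale_left)

definition unit_vector :: "nat \<Rightarrow> ell2" where
  "unit_vector n = ell2_of (\<lambda>j. if j = n then 1 else 0)"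

lemma coord_unit_vector: "coord (unit_vector n) j = (if j = n then 1 else 0)"
  unfolding unit_vector_def
  by (subst coord_ell2_of) (auto intro!: summable_finite[of "{n}"] split: if_splits)

lemma cinner_unit_vector: "cinner (unit_vector n) x = cnj (coord x n)"
proof (rule sums_unique2[OF sums_cinner])
  have "coord (unit_vector n) j * cnj (coord x j) = (if j = n then cnj (coord x j) else 0)" for j
    by (simp add: coord_unit_vector)
  then show "(\<lambda>j. coord (unit_vector n) j * cnj (coord x j)) sums cnj (coord x n)"
    using sums_single[of n "\<lambda>j. cnj (coord x j)"] by simp
qed

lemma sums_coord_unit_vector: "(\<lambda>j. cscale (coord x j) (unit_vector j)) sums x"
proof -
  have partial: "(\<Sum>j<n. cscale (coord x j) (unit_vector j)) = diag (\<lambda>j. if j < n then 1 else 0) x" for n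
  proof (rule ell2_eqI)
    fix i
    have "coord (\<Sum>j<n. cscale (coord x j) (unit_vector j)) i = (\<Sum>j<n. if j = i then coord x j else 0)"
      by (induction n) (auto simp: coord_simps coord_cscale coord_unit_vector)
    also have "\<dots> = (if i < n then 1 else 0) * coord x i"
      by (simp add: sum.delta)
    also have "\<dots> = coord (diag (\<lambda>j. if j < n then 1 else 0) x) i"
      by (rule coord_diag[where K = 1, symmetric]) auto
    finally show "coord (\<Sum>j<n. cscale (coord x j) (unit_vector j)) i
        = coord (diag (\<lambda>j. if j < n then 1 else 0) x) i" .
  qed
  have "(\<lambda>n. diag (\<lambda>j. if j < n then 1 else 0) x) \<longlonglongrightarrow> diag (\<lambda>_. 1) x"
  proof (rule tendsto_diag[where K = 1])
    fix j :: nat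
    have "\<forall>\<^sub>F n in sequentially. (if j < n then 1 else 0) = (1::complex)"
      using eventually_gt_at_top[of j] by eventually_elim simp
    then show "(\<lambda>n. if j < n then 1 else 0) \<longlonglongrightarrow> (1::complex)"
      by (rule tendsto_eventually)
  qed auto
  moreover have "diag (\<lambda>_. 1) x = x"
    by (rule ell2_eqI, subst coord_diag[where K = 1]) auto
  ultimately show ?thesis by (simp add: sums_def partial)
qed

section \<open>The Hilbert space of square summable sequences\<close>

definition ell2_space :: "(nat \<Rightarrow> complex) cspace" where
  "ell2_space = \<lparr>hcarrier = range coord, hscale = (\<lambda>c f j. c * f j),
     hinner = (\<lambda>f g. \<Sum>j. f j * cnj (g j))\<rparr>"

lemma hcarrier_ell2: "hcarrier ell2_space = range coord"
  by (simp add: ell2_space_def)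

lemma coord_in_hcarrier [simp]: "coord x \<in> hcarrier ell2_space"
  by (simp add: hcarrier_ell2)

lemma hcarrier_ell2_iff: "f \<in> hcarrier ell2_space \<longleftrightarrow> summable (\<lambda>j. (cmod (f j))\<^sup>2)"
  unfolding hcarrier_ell2 using square_summable_coord coord_ell2_of by (metis rangeE rangeI)

lemma hcarrier_ell2E:
  assumes "f \<in> hcarrier ell2_space"
  obtains x where "f = coord x"
  using assms by (auto simp: hcarrier_ell2)

lemma ball_hcarrier_ell2: "(\<forall>f\<in>hcarrier ell2_space. P f) \<longleftrightarrow> (\<forall>x. P (coord x))"
  by (auto simp: hcarrier_ell2)

lemma plus_coord: "coord x + coord y = coord (x + y)"
  by (auto simp: coord_add)

lemma minus_coord: "coord x - coord y = coord (x - y)"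
  by (auto simp: coord_diff)

lemma uminus_coord: "- coord x = coord (- x)"
  by (auto simp: coord_minus)

lemma coord_0: "coord 0 = 0"
  by (auto simp: coord_zero)

lemma hscale_coord: "hscale ell2_space c (coord x) = coord (cscale c x)"
  by (auto simp: ell2_space_def coord_cscale)

lemma hinner_coord: "hinner ell2_space (coord x) (coord y) = cinner x y"
  by (simp add: ell2_space_def cinner_def)

lemma hnorm_coord: "hnorm ell2_space (coord x) = norm x"
  by (simp add: hnorm_def hinner_coord norm_ell2_def inner_ell2_def)

lemma hdist_coord: "hdist ell2_space (coord x) (coord y) = dist x y"
  by (simp add: hdist_def minus_coord hnorm_coord dist_norm)

lemmas coord_transfer =
  plus_coord minus_coord uminus_coord hscale_coord hinner_coord hnorm_coord hdist_coord

interpretation ell2_metric: Metric_space "hcarrier ell2_space" "hdist ell2_space"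
proof
  fix f g h :: "nat \<Rightarrow> complex"
  show "0 \<le> hdist ell2_space f g" and "hdist ell2_space f g = hdist ell2_space g f"
    by (auto simp: hdist_def coord_transfer hcarrier_ell2 norm_minus_commute)
  assume "f \<in> hcarrier ell2_space" "g \<in> hcarrier ell2_space"
  then obtain x y where xy: "f = coord x" "g = coord y" by (metis hcarrier_ell2E)
  then show "hdist ell2_space f g = 0 \<longleftrightarrow> f = g"
    by (simp add: hdist_coord coord_inject)
  assume "h \<in> hcarrier ell2_space"
  then obtain z where "h = coord z" by (metis hcarrier_ell2E)
  then show "hdist ell2_space f h \<le> hdist ell2_space f g + hdist ell2_space g h"
    by (simp add: xy hdist_coord dist_triangle)
qed

text \<open>
  The coordinate map identifies the type \<open>ell2\<close>, on which the analysis takes place, with the carrier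
  of the Hilbert space. This lemma and the next ones translate limits, derivatives, continuity and
  density.
\<close>

lemma limitin_coord_iff:
  "limitin (htopology ell2_space) (\<lambda>s. coord (f s)) (coord l) F \<longleftrightarrow> (f \<longlongrightarrow> l) F"
  by (simp add: ell2_metric.limitin_metric hdist_coord tendsto_iff)

lemma has_hderivative_coord_iff:
  "has_hderivative ell2_space (\<lambda>s. coord (f s)) (coord l) t T \<longleftrightarrow>
   (f has_vector_derivative l) (at t within T)"
  unfolding has_hderivative_def minus_coord hscale_coord limitin_coord_iff cscale_of_real
  by (rule has_vector_derivative_iff_difference_quotient[symmetric])

lemma continuous_map_coord:
  assumes "continuous_on T f"
  shows "continuous_map (top_of_set T) (htopology ell2_space) (\<lambda>t. coord (f t))"
  unfolding ell2_metric.continuous_map_to_metric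
proof (intro ballI allI impI)
  fix t e assume t: "t \<in> topspace (top_of_set T)" and e: "(e::real) > 0"
  have "openin (top_of_set T) (T \<inter> f -` ball (f t) e)"
    using assms by (rule continuous_openin_preimage_gen) simp
  then show "\<exists>U. openin (top_of_set T) U \<and> t \<in> U \<and>
      (\<forall>y\<in>U. coord (f y) \<in> ell2_metric.mball (coord (f t)) e)"
    using t e by (intro exI[of _ "T \<inter> f -` ball (f t) e"])
      (auto simp: ell2_metric.in_mball hdist_coord)
qed

lemma closure_of_eq_hcarrier:
  assumes "\<And>x. \<exists>X. (\<forall>n::nat. coord (X n) \<in> S) \<and> X \<longlonglongrightarrow> x"
  shows "htopology ell2_space closure_of S = hcarrier ell2_space"
proof -
  have "\<exists>f\<in>S. f \<in> ell2_metric.mball (coord x) r" if r: "r > 0" for x r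
  proof -
    obtain X where X: "\<forall>n::nat. coord (X n) \<in> S" "X \<longlonglongrightarrow> x" using assms by blast
    from tendstoD[OF X(2) r] obtain n where "dist (X n) x < r"
      by (auto simp: eventually_sequentially)
    then show ?thesis using X(1)
      by (intro bexI[of _ "coord (X n)"]) (auto simp: ell2_metric.in_mball hdist_coord dist_commute)
  qed
  then have "\<exists>g\<in>S. g \<in> ell2_metric.mball f r" if "r > 0" "f \<in> hcarrier ell2_space" for f r
    using that by (metis hcarrier_ell2E)
  then show ?thesis
    unfolding ell2_metric.metric_closure_of by blast
qed

lemma vector_space_ell2: "vector_space (hscale ell2_space)"
  by (simp add: vector_space_def ell2_space_def fun_eq_iff algebra_simps)

lemma module_ell2: "module (hscale ell2_space)"
  using vector_space_ell2 by (simp add: module_def vector_space_def)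

lemma subspace_ell2_iff:
  "module.subspace (hscale ell2_space) S \<longleftrightarrow>
   0 \<in> S \<and> (\<forall>x\<in>S. \<forall>y\<in>S. x + y \<in> S) \<and> (\<forall>c. \<forall>x\<in>S. hscale ell2_space c x \<in> S)"
  by (rule module.subspace_def[OF module_ell2])

lemma complex_hilbert_space_ell2: "complex_hilbert_space ell2_space"
  unfolding complex_hilbert_space_def ball_hcarrier_ell2
proof (intro conjI allI impI)
  show "module.subspace (hscale ell2_space) (hcarrier ell2_space)"
    unfolding subspace_ell2_iff ball_hcarrier_ell2
    by (simp add: coord_transfer flip: coord_0)
  show "ell2_metric.mcomplete"
    unfolding ell2_metric.mcomplete_def
  proof (intro allI impI)
    fix \<sigma> assume \<sigma>: "ell2_metric.MCauchy \<sigma>"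
    then have "\<forall>n. \<exists>x. \<sigma> n = coord x"
      unfolding ell2_metric.MCauchy_def by (metis hcarrier_ell2E rangeI subsetD)
    then obtain X where X: "\<sigma> = (\<lambda>n. coord (X n))" by metis
    have "Cauchy X"
      using \<sigma> unfolding ell2_metric.MCauchy_def X by (simp add: hdist_coord Cauchy_def)
    then obtain x where "X \<longlonglongrightarrow> x" using Cauchy_convergent convergent_def by blast
    then show "\<exists>l. limitin (htopology ell2_space) \<sigma> l sequentially"
      unfolding X using limitin_coord_iff by blast
  qed
  show "0 < Re (hinner ell2_space (coord x) (coord x))" if "coord x \<noteq> 0" for x
  proof -
    have "x \<noteq> 0" using that by (auto simp: coord_0)
    then show ?thesis using inner_gt_zero_iff[of x] by (simp add: hinner_coord inner_ell2_def)
  qed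
  show "hinner ell2_space (coord y) (coord x) = cnj (hinner ell2_space (coord x) (coord y))" for x y
    unfolding hinner_coord by (rule cinner_commute)
qed (simp_all add: vector_space_ell2 coord_transfer cinner_add_left cinner_cscale_left)

lemma subspace_hcarrier_ell2: "module.subspace (hscale ell2_space) (hcarrier ell2_space)"
  using complex_hilbert_space_ell2 by (simp add: complex_hilbert_space_def)

text \<open>
  A countable dense set consists of the finite combinations of the unit vectors with coefficients in
  a countable dense set of complex numbers; they approximate the partial sums of every vector.
\<close>

lemma separable_hilbert_space_ell2: "separable_hilbert_space ell2_space"
  unfolding separable_hilbert_space_def separable_space_def
proof (intro conjI complex_hilbert_space_ell2)
  obtain Q :: "complex set" where Q: "countable Q" and "UNIV \<subseteq> closure Q"
    by (rule separable[of "UNIV :: complex set"])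
  then have clQ: "closure Q = UNIV" by blast
  \<comment> \<open>\<open>C n\<close> is the set of combinations of the first \<open>n\<close> unit vectors with coefficients in \<open>Q\<close>.\<close>
  define step where "step n = (\<lambda>(y, q). y + cscale q (unit_vector n))" for n
  define C where "C = rec_nat {0} (\<lambda>n S. step n ` (S \<times> Q))"
  have C: "C 0 = {0}" "C (Suc n) = step n ` (C n \<times> Q)" for n
    by (simp_all add: C_def)
  have cont: "continuous_on UNIV (step n)" for n
  proof -
    have "continuous_on UNIV (\<lambda>p::ell2 \<times> complex. cscale (snd p) (unit_vector n))"
      by (rule bounded_linear.continuous_on[OF bounded_linear_cscale_left]) (intro continuous_intros)
    then show ?thesis
      unfolding step_def case_prod_unfold by (intro continuous_intros)
  qed
  have dense: "(\<Sum>j<n. cscale (coord x j) (unit_vector j)) \<in> closure (C n)" for n x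
  proof (induction n)
    case (Suc n)
    have "step n ((\<Sum>j<n. cscale (coord x j) (unit_vector j)), coord x n) \<in> step n ` closure (C n \<times> Q)"
      using Suc by (intro imageI) (simp add: closure_Times clQ)
    also have "\<dots> \<subseteq> closure (C (Suc n))"
      unfolding C by (rule continuous_image_closure_subset[OF cont]) simp
    finally show ?case by (simp add: step_def)
  qed (simp add: C)
  have "htopology ell2_space closure_of (coord ` (\<Union>n. C n)) = hcarrier ell2_space"
  proof (rule closure_of_eq_hcarrier)
    fix x
    have "(\<Sum>j<n. cscale (coord x j) (unit_vector j)) \<in> closure (\<Union>n. C n)" for n
      using dense[where n = n and x = x] closure_mono[of "C n" "\<Union>n. C n"] by auto
    then have "x \<in> closure (\<Union>n. C n)"
      by (rule closed_sequentially[OF closed_closure _ sums_coord_unit_vector[of x, unfolded sums_def]])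
    then show "\<exists>X. (\<forall>n::nat. coord (X n) \<in> coord ` (\<Union>n. C n)) \<and> X \<longlonglongrightarrow> x"
      unfolding closure_sequential by blast
  qed
  moreover have "countable (C n)" for n
    by (induction n) (auto simp: C Q intro!: countable_SIGMA)
  ultimately show "\<exists>S. countable S \<and> S \<subseteq> topspace (htopology ell2_space) \<and>
      htopology ell2_space closure_of S = topspace (htopology ell2_space)"
    by (intro exI[of _ "coord ` (\<Union>n. C n)"]) auto
qed

lemma closure_of_span_unit_vectors:
  assumes S: "module.subspace (hscale ell2_space) S" and e: "\<And>n. coord (unit_vector n) \<in> S"
  shows "htopology ell2_space closure_of S = hcarrier ell2_space"
proof (rule closure_of_eq_hcarrier)
  fix x
  have "coord (\<Sum>j<n. cscale (coord x j) (unit_vector j)) \<in> S" for n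
    using S e by (induction n) (auto simp: subspace_ell2_iff coord_0 plus_coord[symmetric] hscale_coord[symmetric])
  then show "\<exists>X. (\<forall>n::nat. coord (X n) \<in> S) \<and> X \<longlonglongrightarrow> x"
    using sums_coord_unit_vector[of x] unfolding sums_def
    by (intro exI[of _ "\<lambda>n. \<Sum>j<n. cscale (coord x j) (unit_vector j)"]) blast
qed

lemma hilbert_basis_unit_vectors:
  "hilbert_basis ell2_space {1..} (\<lambda>n. coord (unit_vector (n - 1)))"
  unfolding hilbert_basis_def
proof (intro conjI ballI)
  let ?\<phi> = "\<lambda>n. coord (unit_vector (n - 1))"
  show "?\<phi> ` {1..} \<subseteq> hcarrier ell2_space" by auto
  show "hinner ell2_space (?\<phi> j) (?\<phi> k) = (if j = k then 1 else 0)"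
    if "j \<in> {1..}" "k \<in> {1..}" for j k :: nat
    using that by (auto simp: hinner_coord cinner_unit_vector coord_unit_vector)
  show "htopology ell2_space closure_of module.span (hscale ell2_space) (?\<phi> ` {1..}) = hcarrier ell2_space"
  proof (rule closure_of_span_unit_vectors)
    show "module.subspace (hscale ell2_space) (module.span (hscale ell2_space) (?\<phi> ` {1..}))"
      by (rule module.subspace_span[OF module_ell2])
    show "coord (unit_vector n) \<in> module.span (hscale ell2_space) (?\<phi> ` {1..})" for n
      by (rule module.span_base[OF module_ell2]) (auto intro!: image_eqI[of _ _ "Suc n"])
  qed
qed

definition on_coords :: "(ell2 \<Rightarrow> ell2) \<Rightarrow> (nat \<Rightarrow> complex) \<Rightarrow> nat \<Rightarrow> complex" where
  "on_coords F f = coord (F (ell2_of f))"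

lemma on_coords [simp]: "on_coords F (coord x) = coord (F x)"
  by (simp add: on_coords_def coord_inverse)

lemma linear_operator_on_coords:
  assumes "linear F" "\<And>c x. F (cscale c x) = cscale c (F x)"
  shows "linear_operator ell2_space (hcarrier ell2_space) (on_coords F)"
  unfolding linear_operator_def ball_hcarrier_ell2
proof (intro conjI allI)
  show "module.subspace (hscale ell2_space) (hcarrier ell2_space)"
    by (rule subspace_hcarrier_ell2)
  show "on_coords F ` hcarrier ell2_space \<subseteq> hcarrier ell2_space"
    by (auto elim!: hcarrier_ell2E)
qed (simp_all add: plus_coord hscale_coord linear_add[OF assms(1)] assms(2))

lemma unitary_operator_on_coords:
  assumes "linear F" "\<And>c x. F (cscale c x) = cscale c (F x)" "\<And>x y. F x \<bullet> F y = x \<bullet> y" "surj F"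
  shows "unitary_operator ell2_space (on_coords F)"
  unfolding unitary_operator_def ball_hcarrier_ell2
proof (intro conjI allI linear_operator_on_coords)
  show "on_coords F ` hcarrier ell2_space = hcarrier ell2_space"
  proof -
    have "on_coords F ` range coord = coord ` range F"
      by (simp only: image_image on_coords)
    then show ?thesis by (simp only: hcarrier_ell2 \<open>surj F\<close>)
  qed
  show "hinner ell2_space (on_coords F (coord x)) (on_coords F (coord y))
      = hinner ell2_space (coord x) (coord y)" for x y
    by (simp add: hinner_coord cinner_via_inner assms(3) flip: assms(2))
qed (use assms in auto)

section \<open>Propagators of constant controls\<close>

lemma pieces_le: "pieces v a ps b \<Longrightarrow> a \<le> b"
  by (induction v a ps b rule: pieces.induct) auto

text \<open>
  Only the breakpoints matter for the variation: on an interval that avoids them the function is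
  constant. The zero-length pieces and the arbitrary values at the breakpoints are thereby treated
  alike.
\<close>

lemma pieces_breakpoints:
  assumes "pieces v a ps b"
  obtains P where "finite P" "finite (v ` {a..b})"
    "\<And>x y. a \<le> x \<Longrightarrow> x \<le> y \<Longrightarrow> y \<le> b \<Longrightarrow> {x..y} \<inter> P = {} \<Longrightarrow> v x = v y"
proof -
  have "\<exists>P. finite P \<and> finite (v ` {a..b}) \<and>
      (\<forall>x y. a \<le> x \<longrightarrow> x \<le> y \<longrightarrow> y \<le> b \<longrightarrow> {x..y} \<inter> P = {} \<longrightarrow> v x = v y)"
    using assms
  proof (induction v a ps b rule: pieces.induct)
    case (1 v a b)
    then show ?case by (intro exI[of _ "{a}"]) auto
  next
    case (2 v a l c ps b)
    then have l: "0 \<le> l" and c: "\<forall>s\<in>{a<..<a + l}. v s = c" and rest: "pieces v (a + l) ps b"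
      by auto
    from 2(1)[OF rest] obtain P where P: "finite P" "finite (v ` {a + l..b})"
      "\<forall>x y. a + l \<le> x \<longrightarrow> x \<le> y \<longrightarrow> y \<le> b \<longrightarrow> {x..y} \<inter> P = {} \<longrightarrow> v x = v y" by blast
    have "v x = v y" if xy: "a \<le> x" "x \<le> y" "y \<le> b" and disj: "{x..y} \<inter> insert a (insert (a + l) P) = {}" for x y
    proof (cases "a + l \<le> x")
      case True
      then show ?thesis using P(3) xy disj by auto
    next
      case False
      moreover have "x \<noteq> a" "\<not> (x \<le> a + l \<and> a + l \<le> y)" using xy disj by auto
      ultimately show ?thesis using c xy by auto
    qed
    moreover have "v ` {a..b} \<subseteq> {v a, c} \<union> v ` {a + l..b}"
    proof
      fix z assume "z \<in> v ` {a..b}"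
      then obtain x where "z = v x" "a \<le> x" "x \<le> b" by auto
      then show "z \<in> {v a, c} \<union> v ` {a + l..b}"
        using c by (cases "x = a"; cases "x < a + l") auto
    qed
    then have "finite (v ` {a..b})" by (rule finite_subset) (use P in auto)
    ultimately show ?case using P(1) by (intro exI[of _ "insert a (insert (a + l) P)"]) auto
  qed
  then show thesis using that by blast
qed

lemma variation_sums_pair:
  assumes "0 \<le> x" "x \<le> y" "y \<le> T"
  shows "\<bar>u y - u x\<bar> \<in> variation_sums T u"
  unfolding variation_sums_def
  using assms by (intro CollectI exI[of _ 1] exI[of _ "\<lambda>i. if i = 0 then x else y"]) auto

lemma bounded_variation_if_increment_bound:
  assumes g: "\<And>x y. 0 \<le> x \<Longrightarrow> x \<le> y \<Longrightarrow> y \<le> T \<Longrightarrow> \<bar>u y - u x\<bar> \<le> g y - g x"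
  shows "bounded_variation T u"
  unfolding bounded_variation_def
proof (rule bdd_aboveI[where M = "g T - g 0"])
  fix S assume "S \<in> variation_sums T u"
  then obtain n s where S: "S = (\<Sum>i<n. \<bar>u (s (Suc i)) - u (s i)\<bar>)"
    and s: "\<forall>i\<le>n. s i \<in> {0..T}" "\<forall>i<n. s i \<le> s (Suc i)"
    unfolding variation_sums_def by blast
  have "S \<le> (\<Sum>i<n. g (s (Suc i)) - g (s i))"
    unfolding S using s by (intro sum_mono g) (auto simp: Suc_le_eq)
  also have "\<dots> = g (s n) - g (s 0)" by (rule sum_lessThan_telescope)
  also have "\<dots> \<le> g T - g 0"
    using g[of "s n" T] g[of 0 "s 0"] s(1) by fastforce
  finally show "S \<le> g T - g 0" .
qed

text \<open>
  Total variation is a supremum, which carries information only for a bounded set of sums. Here the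
  increments are dominated by those of a multiple of a function that counts breakpoints.
\<close>

lemma bounded_variation_piecewise_constant:
  assumes "piecewise_constant T v"
  shows "bounded_variation T v"
proof -
  from assms obtain ps where "pieces v 0 ps T" by (auto simp: piecewise_constant_def)
  then obtain P where P: "finite P" and fin: "finite (v ` {0..T})"
    and eq: "\<And>x y. 0 \<le> x \<Longrightarrow> x \<le> y \<Longrightarrow> y \<le> T \<Longrightarrow> {x..y} \<inter> P = {} \<Longrightarrow> v x = v y"
    by (rule pieces_breakpoints) blast
  obtain K where K: "\<And>x. x \<in> {0..T} \<Longrightarrow> \<bar>v x\<bar> \<le> K"
    using finite_imp_bounded[OF fin] unfolding bounded_iff by fastforce
  \<comment> \<open>Every breakpoint in \<open>[x, y]\<close> must be noticed, including one equal to \<open>x\<close> or to \<open>y\<close>; counting the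
    breakpoints both up to \<open>x\<close> and strictly below \<open>x\<close> achieves this.\<close>
  define N where "N x = real (card (P \<inter> {..x}) + card (P \<inter> {..<x}))" for x
  have "\<bar>v y - v x\<bar> \<le> 2 * K * N y - 2 * K * N x" if xy: "0 \<le> x" "x \<le> y" "y \<le> T" for x y
  proof (cases "{x..y} \<inter> P = {} \<or> x = y")
    case True
    have "N x \<le> N y"
      unfolding N_def using xy P by (intro of_nat_mono add_mono card_mono) auto
    moreover have "0 \<le> K" using K[of x] xy by auto
    ultimately have "0 \<le> 2 * K * (N y - N x)" by simp
    moreover have "v x = v y" using True eq[OF xy] by blast
    ultimately show ?thesis by (simp add: algebra_simps)
  next
    case False
    then obtain p where p: "p \<in> P" "x \<le> p" "p \<le> y" and "x < y" using xy by auto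
    have le: "card (P \<inter> {..x}) \<le> card (P \<inter> {..y})" "card (P \<inter> {..<x}) \<le> card (P \<inter> {..<y})"
      using xy P by (intro card_mono; auto)+
    have "card (P \<inter> {..x}) < card (P \<inter> {..y}) \<or> card (P \<inter> {..<x}) < card (P \<inter> {..<y})"
    proof (cases "x < p")
      case True
      then have "p \<in> P \<inter> {..y} - P \<inter> {..x}" "P \<inter> {..x} \<subseteq> P \<inter> {..y}" using p xy by auto
      then have "P \<inter> {..x} \<subset> P \<inter> {..y}" by blast
      then show ?thesis using psubset_card_mono[of "P \<inter> {..y}"] P by blast
    next
      case False
      then have "p \<in> P \<inter> {..<y} - P \<inter> {..<x}" "P \<inter> {..<x} \<subseteq> P \<inter> {..<y}"
        using p \<open>x < y\<close> by auto
      then have "P \<inter> {..<x} \<subset> P \<inter> {..<y}" by blast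
      then show ?thesis using psubset_card_mono[of "P \<inter> {..<y}"] P by blast
    qed
    then have "N x + 1 \<le> N y" using le unfolding N_def by linarith
    moreover have "0 \<le> K" using K[of x] xy by auto
    ultimately have "2 * K * 1 \<le> 2 * K * (N y - N x)" by (intro mult_left_mono) auto
    moreover have "\<bar>v y - v x\<bar> \<le> 2 * K" using K[of x] K[of y] xy by auto
    ultimately show ?thesis by (simp add: algebra_simps)
  qed
  then show ?thesis by (rule bounded_variation_if_increment_bound)
qed

lemma constant_if_total_variation_le_0:
  assumes bv: "bounded_variation T v" and tv: "total_variation T v \<le> 0" and s: "s \<in> {0..T}"
  shows "v s = v 0"
proof -
  have "\<bar>v s - v 0\<bar> \<le> total_variation T v"
    unfolding total_variation_def
    using bv s by (intro cSup_upper variation_sums_pair) (auto simp: bounded_variation_def)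
  then show ?thesis using tv by simp
qed

lemma variation_sums_const: "0 \<le> T \<Longrightarrow> variation_sums T (\<lambda>_. c) = {0}"
  using variation_sums_pair[of 0 0 T "\<lambda>_. c"] by (auto simp: variation_sums_def)

text \<open>
  A piece of positive length shows the value \<open>d\<close> at its midpoint, while the value attached to a piece
  of length zero is arbitrary but contributes the identity.
\<close>

lemma piecewise_propagator_const:
  assumes "pieces v a ps b" and "\<And>s. s \<in> {a..b} \<Longrightarrow> v s = d"
    and E0: "\<And>c \<psi>. \<psi> \<in> X \<Longrightarrow> E c 0 \<psi> = \<psi>"
    and Eadd: "\<And>s t \<psi>. \<psi> \<in> X \<Longrightarrow> E d (s + t) \<psi> = E d s (E d t \<psi>)"
    and EX: "\<And>t \<psi>. \<psi> \<in> X \<Longrightarrow> E d t \<psi> \<in> X"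
    and "\<psi> \<in> X"
  shows "piecewise_propagator E ps \<psi> = E d (b - a) \<psi>"
  using assms(1,2,6)
proof (induction v a ps b arbitrary: \<psi> rule: pieces.induct)
  case (1 v a b)
  then show ?case by (simp add: piecewise_propagator_def E0)
next
  case (2 v a l c ps b)
  then have l: "0 \<le> l" and c: "\<forall>s\<in>{a<..<a + l}. v s = c" and rest: "pieces v (a + l) ps b"
    by auto
  have step: "E c l \<psi> = E d l \<psi>"
  proof (cases "l = 0")
    case True
    then show ?thesis using E0 \<open>\<psi> \<in> X\<close> by simp
  next
    case False
    then have "v (a + l / 2) = c" using c l by auto
    moreover have "v (a + l / 2) = d" using 2(3) l pieces_le[OF rest] by auto
    ultimately show ?thesis by simp
  qed
  have "piecewise_propagator E ((l, c) # ps) \<psi> = piecewise_propagator E ps (E d l \<psi>)"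
    by (simp add: piecewise_propagator_def step)
  also have "\<dots> = E d (b - (a + l)) (E d l \<psi>)"
    using l by (intro 2(1) rest EX 2(3) \<open>\<psi> \<in> X\<close>) auto
  also have "\<dots> = E d (b - a) \<psi>"
    using Eadd[OF \<open>\<psi> \<in> X\<close>, of "b - (a + l)" l] by simp
  finally show ?case .
qed

text \<open>
  A constant control has total variation \<open>0\<close>, so the admissible piecewise constant approximations
  are constant functions \<open>d n\<close> converging to \<open>c\<close>. The approximation property of the propagator thus
  reduces to the strong continuity of \<open>c \<mapsto> exp (t (A + c B))\<close>.
\<close>

theorem is_propagator_const:
  assumes T: "0 \<le> T"
    and E: "\<And>c. unitary_group_generated_by H D (\<lambda>\<psi>. A \<psi> + hscale H (complex_of_real c) (B \<psi>)) (E c)"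
    and cont: "\<And>d t \<psi>. d \<longlonglongrightarrow> c \<Longrightarrow> 0 \<le> t \<Longrightarrow> \<psi> \<in> hcarrier H \<Longrightarrow>
        limitin (htopology H) (\<lambda>n. E (d n) t \<psi>) (E c t \<psi>) sequentially"
    and contT: "\<And>\<psi>. \<psi> \<in> hcarrier H \<Longrightarrow>
        continuous_map (top_of_set {0..T}) (htopology H) (\<lambda>t. E c t \<psi>)"
    and inv: "\<And>t. E c t ` D \<subseteq> D"
    and deriv: "\<And>\<psi> t. \<psi> \<in> D \<Longrightarrow>
        has_hderivative H (\<lambda>s. E c s \<psi>)
          (A (E c t \<psi>) + hscale H (complex_of_real c) (B (E c t \<psi>))) t {0..T}"
  shows "is_propagator H D A B T (\<lambda>_. c) (E c)"
proof -
  have unit: "unitary_operator H (E d t)" and E0: "\<psi> \<in> hcarrier H \<Longrightarrow> E d 0 \<psi> = \<psi>"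
    and Eadd: "\<psi> \<in> hcarrier H \<Longrightarrow> E d (s + t) \<psi> = E d s (E d t \<psi>)" for d s t \<psi>
    using E[of d] by (auto simp: unitary_group_generated_by_def)
  have EH: "\<psi> \<in> hcarrier H \<Longrightarrow> E d t \<psi> \<in> hcarrier H" for d t \<psi>
    using unit[of d t] unfolding unitary_operator_def by blast
  have approx: "limitin (htopology H) (\<lambda>n. piecewise_propagator E (ps n) \<psi>) (E c t \<psi>) sequentially"
    if v: "\<forall>n. piecewise_constant T (v n)" "\<forall>s\<in>{0..T}. (\<lambda>n. v n s) \<longlonglongrightarrow> c"
      "\<forall>n. total_variation T (v n) \<le> total_variation T (\<lambda>_. c)"
      and t: "t \<in> {0..T}" and ps: "\<forall>n. pieces (v n) 0 (ps n) t" and \<psi>: "\<psi> \<in> hcarrier H"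
    for v t ps \<psi>
  proof -
    have const: "v n s = v n 0" if "s \<in> {0..T}" for n s
    proof (rule constant_if_total_variation_le_0[OF _ _ that])
      show "bounded_variation T (v n)"
        using v(1) by (intro bounded_variation_piecewise_constant) blast
      have "total_variation T (\<lambda>_. c) = 0"
        by (simp add: total_variation_def variation_sums_const[OF T])
      then show "total_variation T (v n) \<le> 0" using v(3) by metis
    qed
    have "piecewise_propagator E (ps n) \<psi> = E (v n 0) (t - 0) \<psi>" for n
    proof (rule piecewise_propagator_const[where v = "v n" and X = "hcarrier H"])
      show "pieces (v n) 0 (ps n) t" using ps by blast
      show "v n s = v n 0" if "s \<in> {0..t}" for s using that t by (intro const) auto
    qed (fact E0 Eadd EH \<psi>)+
    moreover have "(\<lambda>n. v n 0) \<longlonglongrightarrow> c" using v(2) T by simp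
    ultimately show ?thesis using cont[of "\<lambda>n. v n 0" t \<psi>] t \<psi> by simp
  qed
  show ?thesis
    unfolding is_propagator_def
  proof (intro conjI ballI exI[of _ E] allI impI)
    show "AE t in lebesgue_on {0<..T}. has_hderivative H (\<lambda>s. E c s \<psi>)
        (A (E c t \<psi>) + hscale H (complex_of_real c) (B (E c t \<psi>))) t {0..T}" if "\<psi> \<in> D" for \<psi>
      using deriv[OF that] by (intro AE_I2)
    show "limitin (htopology H) (\<lambda>n. piecewise_propagator E (ps n) \<psi>) (E c t \<psi>) sequentially"
      if "(\<forall>n. piecewise_constant T (v n)) \<and> (\<forall>s\<in>{0..T}. (\<lambda>n. v n s) \<longlonglongrightarrow> c) \<and>
          (\<forall>n. \<forall>s\<in>{0..T}. \<bar>v n s\<bar> \<le> \<bar>c\<bar>) \<and>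
          (\<forall>n. total_variation T (v n) \<le> total_variation T (\<lambda>_. c))"
        "t \<in> {0..T}" "\<forall>n. pieces (v n) 0 (ps n) t" "\<psi> \<in> hcarrier H" for v t ps \<psi>
      using that by (intro approx[of v]) blast+
  qed (simp_all add: unit E0 contT inv E)
qed

section \<open>Diagonal generators and their bounded perturbations\<close>

definition energy_domain :: "(nat \<Rightarrow> real) \<Rightarrow> (nat \<Rightarrow> complex) set" where
  "energy_domain a = {f \<in> hcarrier ell2_space. (\<lambda>j. a j * f j) \<in> hcarrier ell2_space}"

definition diag_generator :: "(nat \<Rightarrow> real) \<Rightarrow> (nat \<Rightarrow> complex) \<Rightarrow> nat \<Rightarrow> complex" where
  "diag_generator a f = (\<lambda>j. - \<i> * a j * f j)"

lemma energy_domain_iff_generator: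
  "f \<in> energy_domain a \<longleftrightarrow> f \<in> hcarrier ell2_space \<and> diag_generator a f \<in> hcarrier ell2_space"
  by (simp add: energy_domain_def diag_generator_def hcarrier_ell2_iff norm_mult)

lemma subspace_energy_domain: "module.subspace (hscale ell2_space) (energy_domain a)"
proof -
  let ?H = "hcarrier ell2_space" and ?m = "\<lambda>f j. complex_of_real (a j) * f j"
  have H: "0 \<in> ?H" "\<And>f g. f \<in> ?H \<Longrightarrow> g \<in> ?H \<Longrightarrow> f + g \<in> ?H"
    "\<And>c f. f \<in> ?H \<Longrightarrow> hscale ell2_space c f \<in> ?H"
    using subspace_hcarrier_ell2 unfolding subspace_ell2_iff by blast+
  have m: "?m 0 = 0" "?m (f + g) = ?m f + ?m g"
    "?m (hscale ell2_space c f) = hscale ell2_space c (?m f)" for f g c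
    by (auto simp: ell2_space_def distrib_left)
  show ?thesis
    unfolding subspace_ell2_iff
  proof (intro conjI ballI allI)
    show "0 \<in> energy_domain a"
      unfolding energy_domain_def mem_Collect_eq m using H(1) by blast
    fix f assume f: "f \<in> energy_domain a"
    show "f + g \<in> energy_domain a" if "g \<in> energy_domain a" for g
      using f that H(2) unfolding energy_domain_def mem_Collect_eq m by blast
    show "hscale ell2_space c f \<in> energy_domain a" for c
      using f H(3) unfolding energy_domain_def mem_Collect_eq m by blast
  qed
qed

lemma unit_vector_in_energy_domain: "coord (unit_vector n) \<in> energy_domain a"
  unfolding energy_domain_def hcarrier_ell2_iff
  by (auto simp: coord_unit_vector intro!: summable_finite[of "{n}"] split: if_splits)

lemma linear_operator_diag_generator:
  "linear_operator ell2_space (energy_domain a) (diag_generator a)"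
  unfolding linear_operator_def
  using subspace_energy_domain
  by (auto simp: energy_domain_iff_generator)
     (auto simp: diag_generator_def ell2_space_def plus_fun_def algebra_simps)

text \<open>
  Testing the adjoint relation on the unit vectors determines the adjoint coordinatewise, and
  square summability of the outcome is exactly membership in the domain.
\<close>

theorem skew_adjoint_diag_generator:
  "skew_adjoint ell2_space (energy_domain a) (diag_generator a)"
  unfolding skew_adjoint_def
proof (intro conjI linear_operator_diag_generator)
  let ?D = "energy_domain a" and ?A = "diag_generator a"
  show "htopology ell2_space closure_of ?D = hcarrier ell2_space"
    by (intro closure_of_span_unit_vectors subspace_energy_domain unit_vector_in_energy_domain)
  show "adjoint_graph ell2_space ?D ?A = (\<lambda>\<psi>. (\<psi>, - ?A \<psi>)) ` ?D"
  proof (intro set_eqI iffI)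
    fix p assume "p \<in> adjoint_graph ell2_space ?D ?A"
    then obtain x y where p: "p = (coord x, coord y)"
      and adj: "\<And>\<xi>. \<xi> \<in> ?D \<Longrightarrow> hinner ell2_space (?A \<xi>) (coord x) = hinner ell2_space \<xi> (coord y)"
      unfolding adjoint_graph_def by (auto simp: hcarrier_ell2)
    have "coord y j = \<i> * a j * coord x j" for j
    proof -
      have "?A (coord (unit_vector j)) = coord (cscale (- \<i> * a j) (unit_vector j))"
        by (auto simp: diag_generator_def coord_cscale coord_unit_vector)
      then have "- \<i> * a j * cnj (coord x j) = cnj (coord y j)"
        using adj[OF unit_vector_in_energy_domain[of j a]]
        by (simp add: hinner_coord cinner_cscale_left cinner_unit_vector)
      from arg_cong[OF this, of cnj] show ?thesis by simp
    qed
    then have "coord y = - ?A (coord x)"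
      by (auto simp: diag_generator_def)
    moreover from this have "?A (coord x) = coord (- y)"
      by (simp add: uminus_coord[symmetric])
    ultimately show "p \<in> (\<lambda>\<psi>. (\<psi>, - ?A \<psi>)) ` ?D"
      unfolding p by (intro image_eqI[of _ _ "coord x"]) (simp_all add: energy_domain_iff_generator)
  next
    fix p assume "p \<in> (\<lambda>\<psi>. (\<psi>, - ?A \<psi>)) ` ?D"
    then obtain f where p: "p = (f, - ?A f)" and f: "f \<in> ?D" by blast
    obtain x y where x: "f = coord x" and y: "?A f = coord y"
      using f by (auto simp: energy_domain_iff_generator hcarrier_ell2)
    have "hinner ell2_space (?A \<xi>) f = hinner ell2_space \<xi> (- ?A f)" for \<xi>
      by (simp add: ell2_space_def diag_generator_def mult_ac)
    moreover have "- ?A f \<in> hcarrier ell2_space" by (simp add: y uminus_coord)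
    ultimately show "p \<in> adjoint_graph ell2_space ?D ?A"
      unfolding p adjoint_graph_def by (simp add: x)
  qed
qed

lemma positive_operator_diag_generator:
  assumes a: "\<And>j. 0 \<le> a j"
  shows "positive_operator ell2_space (energy_domain a) (\<lambda>\<psi>. hscale ell2_space \<i> (diag_generator a \<psi>))"
  unfolding positive_operator_def
proof
  fix f assume f: "f \<in> energy_domain a"
  then obtain x y where x: "f = coord x" and y: "(\<lambda>j. a j * f j) = coord y"
    by (auto simp: energy_domain_def hcarrier_ell2)
  have "hscale ell2_space \<i> (diag_generator a f) = coord y"
    unfolding y[symmetric] by (auto simp: ell2_space_def diag_generator_def mult.assoc[symmetric])
  moreover have "coord y j * cnj (coord x j) = complex_of_real (a j * (cmod (coord x j))\<^sup>2)" for j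
    unfolding fun_cong[OF y, of j, symmetric]
    by (simp only: x of_real_mult complex_norm_square mult.assoc)
  then have sums: "(\<lambda>j. complex_of_real (a j * (cmod (coord x j))\<^sup>2)) sums cinner y x"
    using sums_cinner[of y x] by simp
  have "(\<lambda>j. 0) sums Im (cinner y x)" using sums_Im[OF sums] by simp
  then have "Im (cinner y x) = 0" by (rule sums_unique2[OF _ sums_zero])
  moreover have "0 \<le> Re (cinner y x)"
    by (rule sums_le[OF _ sums_zero sums_Re[OF sums]]) (simp add: a)
  ultimately show "hinner ell2_space (hscale ell2_space \<i> (diag_generator a f)) f \<in> \<real> \<and>
      0 \<le> Re (hinner ell2_space (hscale ell2_space \<i> (diag_generator a f)) f)"
    by (simp add: x hinner_coord complex_is_Real_iff)
qed

lemma cmod_cis_minus_1_le: "cmod (cis s - 1) \<le> \<bar>s\<bar>"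
proof -
  have "(cmod (cis s - 1))\<^sup>2 = (cos s - 1)\<^sup>2 + (sin s)\<^sup>2"
    by (simp add: cmod_power2)
  also have "\<dots> = 2 - 2 * cos s"
    using sin_cos_squared_add[of s] by (simp add: power2_diff)
  also have "\<dots> = (2 * sin (s / 2))\<^sup>2"
    using cos_double_sin[of "s / 2"] by (simp add: power_mult_distrib)
  also have "\<dots> \<le> \<bar>s\<bar>\<^sup>2"
    using abs_sin_x_le_abs_x[of "s / 2"] by (intro abs_le_square_iff[THEN iffD1]) simp
  finally show ?thesis by (rule power2_le_imp_le) simp
qed

text \<open>
  The difference quotient of \<open>t \<mapsto> cis (- a t)\<close> at \<open>0\<close> is \<open>- \<i> a\<close> times \<open>cis_quotient (a t)\<close>, a
  multiplier that is bounded by \<open>1\<close> uniformly in \<open>a\<close> and tends to \<open>1\<close>. The value at \<open>0\<close> makes it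
  continuous there and lets the identity hold for \<open>a = 0\<close> too.
\<close>

definition cis_quotient :: "real \<Rightarrow> complex" where
  "cis_quotient s = (if s = 0 then 1 else (cis (- s) - 1) / (- \<i> * s))"

lemma cmod_cis_quotient_le: "cmod (cis_quotient s) \<le> 1"
  using cmod_cis_minus_1_le[of "- s"] by (simp add: cis_quotient_def norm_divide norm_mult divide_le_eq_1)

lemma isCont_cis_quotient: "isCont cis_quotient 0"
proof -
  have "((\<lambda>s. cis (- s)) has_vector_derivative - \<i>) (at 0)"
    unfolding has_vector_derivative_def by (auto intro!: derivative_eq_intros)
  then have "((\<lambda>s. (1 / s) *\<^sub>R (cis (- s) - 1)) \<longlongrightarrow> - \<i>) (at 0)"
    by (simp add: has_vector_derivative_iff_difference_quotient)
  then have "((\<lambda>s. (1 / s) *\<^sub>R (cis (- s) - 1) / (- \<i>)) \<longlongrightarrow> - \<i> / (- \<i>)) (at 0)"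
    by (intro tendsto_divide tendsto_const) auto
  then have "((\<lambda>s. (1 / s) *\<^sub>R (cis (- s) - 1) / (- \<i>)) \<longlongrightarrow> 1) (at 0)" by simp
  moreover have "(1 / s) *\<^sub>R (cis (- s) - 1) / (- \<i>) = cis_quotient s" if "s \<noteq> 0" for s
    using that unfolding cis_quotient_def scaleR_conv_of_real by (simp add: field_simps)
  then have "\<forall>\<^sub>F s in at 0. (1 / s) *\<^sub>R (cis (- s) - 1) / (- \<i>) = cis_quotient s"
    by (simp add: eventually_at_filter)
  ultimately have "(cis_quotient \<longlongrightarrow> 1) (at 0)" by (rule Lim_transform_eventually)
  then show ?thesis by (simp add: isCont_def cis_quotient_def)
qed

definition free_group :: "(nat \<Rightarrow> real) \<Rightarrow> real \<Rightarrow> ell2 \<Rightarrow> ell2" where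
  "free_group a t = diag (\<lambda>j. cis (- (a j * t)))"

lemma coord_free_group: "coord (free_group a t x) j = cis (- (a j * t)) * coord x j"
  unfolding free_group_def by (rule coord_diag[where K = 1]) simp

lemma cinner_free_group: "cinner (free_group a t x) (free_group a t y) = cinner x y"
proof -
  have "coord (free_group a t x) j * cnj (coord (free_group a t y) j) = coord x j * cnj (coord y j)" for j
  proof -
    have "cis (- (a j * t)) * cnj (cis (- (a j * t))) = 1"
      by (simp add: cis_cnj cis_mult)
    then show ?thesis by (simp add: coord_free_group mult_ac)
  qed
  then show ?thesis by (simp add: cinner_def)
qed

text \<open>
  A derivative can be read off coordinatewise, and since it lies in the space, so does the image of
  \<open>x\<close> under the generator. Conversely, on the domain the difference quotients are bounded multipliers
  applied to that image, and they converge strongly.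
\<close>

theorem free_group_derivative_iff:
  "((\<lambda>t. free_group a t x) has_vector_derivative y) (at 0) \<longleftrightarrow>
   coord x \<in> energy_domain a \<and> coord y = diag_generator a (coord x)"
proof
  assume *: "((\<lambda>t. free_group a t x) has_vector_derivative y) (at 0)"
  have "coord y j = - \<i> * a j * coord x j" for j
  proof -
    have "((\<lambda>t. cis (- (a j * t)) * coord x j) has_vector_derivative coord y j) (at 0)"
      using bounded_linear.has_vector_derivative[OF bounded_linear_coord[of j] *]
      by (simp add: coord_free_group)
    moreover have "((\<lambda>t. cis (- (a j * t)) * coord x j) has_vector_derivative - \<i> * a j * coord x j) (at 0)"
      unfolding has_vector_derivative_def
      by (auto intro!: derivative_eq_intros simp: scaleR_conv_of_real)
    ultimately show ?thesis by (rule vector_derivative_unique_at)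
  qed
  then have "coord y = diag_generator a (coord x)" by (auto simp: diag_generator_def)
  then show "coord x \<in> energy_domain a \<and> coord y = diag_generator a (coord x)"
    unfolding energy_domain_iff_generator by (metis coord_in_hcarrier)
next
  assume *: "coord x \<in> energy_domain a \<and> coord y = diag_generator a (coord x)"
  have "((\<lambda>h. diag (\<lambda>j. cis_quotient (a j * h)) y) \<longlongrightarrow> diag (\<lambda>_. 1) y) (at 0)"
  proof (rule tendsto_diag[where K = 1])
    show "((\<lambda>h. cis_quotient (a j * h)) \<longlongrightarrow> 1) (at 0)" for j
    proof -
      have "((\<lambda>h. a j * h) \<longlongrightarrow> a j * 0) (at 0)" by (intro tendsto_intros)
      then have "((\<lambda>h. a j * h) \<longlongrightarrow> 0) (at 0)" by simp
      from isCont_tendsto_compose[OF isCont_cis_quotient this]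
      show ?thesis by (simp add: cis_quotient_def)
    qed
  qed (simp_all add: cmod_cis_quotient_le)
  moreover have "diag (\<lambda>_. 1) y = y"
    by (rule ell2_eqI, subst coord_diag[where K = 1]) auto
  moreover have "(1 / (h - 0)) *\<^sub>R (free_group a h x - free_group a 0 x)
      = diag (\<lambda>j. cis_quotient (a j * h)) y" if "h \<noteq> 0" for h
  proof (rule ell2_eqI)
    fix j
    have "coord (diag (\<lambda>j. cis_quotient (a j * h)) y) j = cis_quotient (a j * h) * (- \<i> * a j * coord x j)"
      using * by (subst coord_diag[where K = 1]) (simp_all add: cmod_cis_quotient_le diag_generator_def)
    also have "\<dots> = (1 / h) *\<^sub>R ((cis (- (a j * h)) - 1) * coord x j)"
      using that by (cases "a j = 0") (auto simp: cis_quotient_def scaleR_conv_of_real field_simps)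
    finally show "coord ((1 / (h - 0)) *\<^sub>R (free_group a h x - free_group a 0 x)) j
        = coord (diag (\<lambda>j. cis_quotient (a j * h)) y) j"
      by (simp add: coord_simps coord_free_group left_diff_distrib)
  qed
  ultimately show "((\<lambda>t. free_group a t x) has_vector_derivative y) (at 0)"
    unfolding has_vector_derivative_iff_difference_quotient
    by (auto intro: Lim_transform_eventually simp: eventually_at_filter)
qed

locale diagonal_skew_perturbation =
  fixes a :: "nat \<Rightarrow> real" and B :: "ell2 \<Rightarrow> ell2"
  assumes bounded_linear_B: "bounded_linear B"
    and B_cscale: "B (cscale c x) = cscale c (B x)"
    and skew_B: "B x \<bullet> y = - (x \<bullet> B y)"
begin

sublocale skew_perturbation "free_group a" B
proof (rule skew_perturbation.intro)
  show "linear (free_group a t)" for t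
    by (rule linearI) (auto intro!: ell2_eqI simp: coord_free_group coord_simps algebra_simps)
  show "free_group a t x \<bullet> free_group a t y = x \<bullet> y" for t x y
    by (simp add: inner_ell2_def cinner_free_group)
  show "free_group a 0 x = x" for x
    by (rule ell2_eqI) (simp add: coord_free_group)
  show "free_group a (s + t) x = free_group a s (free_group a t x)" for s t x
    by (rule ell2_eqI) (simp add: coord_free_group cis_mult distrib_left mult.assoc[symmetric])
  show "continuous_on UNIV (\<lambda>t. free_group a t x)" for x
    unfolding continuous_on_def free_group_def
    by (intro ballI tendsto_diag[where K = 1] tendsto_intros) auto
qed (fact bounded_linear_B skew_B)+

abbreviation generator :: "real \<Rightarrow> (nat \<Rightarrow> complex) \<Rightarrow> nat \<Rightarrow> complex" where
  "generator c \<equiv> \<lambda>\<psi>. diag_generator a \<psi> + hscale ell2_space (complex_of_real c) (on_coords B \<psi>)"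

lemma flow_cscale: "flow c t (cscale k x) = cscale k (flow c t x)"
proof (rule flow_commute[symmetric, OF bounded_linear_cscale])
  show "cscale k (free_group a t x) = free_group a t (cscale k x)" for t x
    by (rule ell2_eqI) (simp add: coord_cscale coord_free_group mult.left_commute)
qed (rule B_cscale[symmetric])

lemma flow_derivative_0_iff:
  "((\<lambda>t. flow c t x) has_vector_derivative y) (at 0) \<longleftrightarrow>
   coord x \<in> energy_domain a \<and> coord y = generator c (coord x)"
proof -
  have "coord (y - c *\<^sub>R B x) = diag_generator a (coord x) \<longleftrightarrow> coord y = generator c (coord x)"
    by (simp add: hscale_coord cscale_of_real minus_coord[symmetric] diff_eq_eq)
  then show ?thesis
    by (simp add: flow_derivative_iff free_group_derivative_iff)
qed

text \<open>
  The domain of a generator is invariant under its group. In the statement \<open>y\<close> is \<open>A \<psi>(t)\<close> viewed as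
  an element of \<open>ell2\<close>, so that the derivative is the right-hand side of the evolution equation.
\<close>

lemma flow_energy_domain:
  assumes "coord x \<in> energy_domain a"
  obtains y where "coord (flow c t x) \<in> energy_domain a" "coord y = diag_generator a (coord (flow c t x))"
    "((\<lambda>t. flow c t x) has_vector_derivative y + c *\<^sub>R B (flow c t x)) (at t)"
proof -
  obtain z where "coord z = diag_generator a (coord x)"
    using assms by (auto simp: energy_domain_iff_generator hcarrier_ell2)
  then have "((\<lambda>t. flow c t x) has_vector_derivative z + c *\<^sub>R B x) (at 0)"
    using assms by (simp add: flow_derivative_0_iff hscale_coord cscale_of_real plus_coord[symmetric])
  note * = flow_derivative_shift[OF this, of t]
  let ?y = "flow c t (z + c *\<^sub>R B x) - c *\<^sub>R B (flow c t x)"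
  show thesis
  proof
    show "coord (flow c t x) \<in> energy_domain a"
      using *(2) by (simp add: flow_derivative_0_iff)
    show "coord ?y = diag_generator a (coord (flow c t x))"
      using *(2) by (simp add: flow_derivative_0_iff hscale_coord cscale_of_real minus_coord[symmetric])
    show "((\<lambda>t. flow c t x) has_vector_derivative ?y + c *\<^sub>R B (flow c t x)) (at t)"
      using *(1) by simp
  qed
qed

lemma unitary_group_flow:
  "unitary_group_generated_by ell2_space (energy_domain a) (generator c) (\<lambda>t. on_coords (flow c t))"
  unfolding unitary_group_generated_by_def ball_hcarrier_ell2
proof (intro conjI allI)
  show "unitary_operator ell2_space (on_coords (flow c t))" for t
  proof (rule unitary_operator_on_coords[OF linear_flow flow_cscale flow_inner])
    show "surj (flow c t)"
      by (rule surjI[where f = "flow c (- t)"]) (simp add: flow_add[symmetric] flow_0)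
  qed
  show "on_coords (flow c (s + t)) (coord x) = on_coords (flow c s) (on_coords (flow c t) (coord x))" for s t x
    by (simp add: flow_add)
  show "continuous_map euclideanreal (htopology ell2_space) (\<lambda>t. on_coords (flow c t) (coord x))" for x
    using continuous_map_coord[OF continuous_flow[of c x]] by simp
  show "has_hderivative ell2_space (\<lambda>t. on_coords (flow c t) (coord x)) \<eta> 0 UNIV \<longleftrightarrow>
      coord x \<in> energy_domain a \<and> \<eta> = generator c (coord x)" for x \<eta>
  proof (cases "\<eta> \<in> hcarrier ell2_space")
    case True
    then obtain y where "\<eta> = coord y" by (rule hcarrier_ell2E)
    then show ?thesis by (simp add: has_hderivative_coord_iff flow_derivative_0_iff)
  next
    case False
    have "generator c (coord x) \<in> hcarrier ell2_space" if "coord x \<in> energy_domain a"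
      using that by (auto simp: energy_domain_iff_generator hcarrier_ell2 hscale_coord plus_coord)
    then show ?thesis using False
      by (auto simp: has_hderivative_def ell2_metric.limitin_metric)
  qed
qed (simp add: flow_0)

theorem is_propagator_flow:
  assumes T: "0 \<le> T"
  shows "is_propagator ell2_space (energy_domain a) (diag_generator a) (on_coords B) T (\<lambda>_. c)
    (\<lambda>t. on_coords (flow c t))"
proof (rule is_propagator_const[OF T, where E = "\<lambda>c t. on_coords (flow c t)"])
  show "unitary_group_generated_by ell2_space (energy_domain a) (generator c) (\<lambda>t. on_coords (flow c t))" for c
    by (rule unitary_group_flow)
  show "limitin (htopology ell2_space) (\<lambda>n. on_coords (flow (d n) t) \<psi>) (on_coords (flow c t) \<psi>) sequentially"
    if "d \<longlonglongrightarrow> c" "0 \<le> t" "\<psi> \<in> hcarrier ell2_space" for d t \<psi>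
    using that by (auto elim!: hcarrier_ell2E simp: limitin_coord_iff tendsto_flow_parameter)
  show "continuous_map (top_of_set {0..T}) (htopology ell2_space) (\<lambda>t. on_coords (flow c t) \<psi>)"
    if "\<psi> \<in> hcarrier ell2_space" for \<psi>
    using that continuous_map_coord[OF continuous_on_subset[OF continuous_flow]]
    by (auto elim!: hcarrier_ell2E)
  have dom: "\<exists>x. \<psi> = coord x" if "\<psi> \<in> energy_domain a" for \<psi>
    using that by (auto simp: energy_domain_def hcarrier_ell2)
  show "on_coords (flow c t) ` energy_domain a \<subseteq> energy_domain a" for t
  proof
    fix \<eta> assume "\<eta> \<in> on_coords (flow c t) ` energy_domain a"
    then obtain \<psi> where \<psi>: "\<psi> \<in> energy_domain a" "\<eta> = on_coords (flow c t) \<psi>" by blast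
    obtain x where x: "\<psi> = coord x" using dom[OF \<psi>(1)] by blast
    have "coord (flow c t x) \<in> energy_domain a"
      by (rule flow_energy_domain[of x c t]) (use \<psi>(1) x in auto)
    then show "\<eta> \<in> energy_domain a" by (simp add: \<psi>(2) x)
  qed
  show "has_hderivative ell2_space (\<lambda>s. on_coords (flow c s) \<psi>) (generator c (on_coords (flow c t) \<psi>)) t {0..T}"
    if \<psi>: "\<psi> \<in> energy_domain a" for \<psi> t
  proof -
    obtain x where x: "\<psi> = coord x" using dom[OF \<psi>] by blast
    obtain y where y: "coord y = diag_generator a (coord (flow c t x))"
      and der: "((\<lambda>t. flow c t x) has_vector_derivative y + c *\<^sub>R B (flow c t x)) (at t)"
      using flow_energy_domain[of x c t] \<psi> x by metis
    have "generator c (on_coords (flow c t) \<psi>) = coord (y + c *\<^sub>R B (flow c t x))"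
      by (simp add: x y[symmetric] hscale_coord cscale_of_real plus_coord)
    then show ?thesis
      using has_vector_derivative_at_within[OF der] by (simp add: x has_hderivative_coord_iff)
  qed
qed

lemma skew_symmetric_on_coords: "skew_symmetric ell2_space (hcarrier ell2_space) (on_coords B)"
  unfolding skew_symmetric_def ball_hcarrier_ell2
proof (intro conjI allI)
  show "linear_operator ell2_space (hcarrier ell2_space) (on_coords B)"
    by (intro linear_operator_on_coords bounded_linear.linear[OF bounded_linear_B] B_cscale)
  show "hinner ell2_space (on_coords B (coord x)) (coord y)
      = - hinner ell2_space (coord x) (on_coords B (coord y))" for x y
    using skew_B[of x y] skew_B[of "cscale \<i> x" y]
    by (simp add: hinner_coord cinner_via_inner complex_eq_iff B_cscale)
qed

lemma hnorm_on_coords_le: "\<psi> \<in> hcarrier ell2_space \<Longrightarrow>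
    hnorm ell2_space (on_coords B \<psi>) \<le> onorm B * hnorm ell2_space \<psi>"
  using onorm[OF bounded_linear_B] by (auto elim!: hcarrier_ell2E simp: hnorm_coord)

lemma bounded_operator_on_coords: "bounded_operator ell2_space (on_coords B)"
  unfolding bounded_operator_def
proof
  show "linear_operator ell2_space (hcarrier ell2_space) (on_coords B)"
    using skew_symmetric_on_coords by (simp add: skew_symmetric_def)
qed (use hnorm_on_coords_le in blast)

end

section \<open>Rank one controls and the growth of the energy\<close>

definition rank_one :: "ell2 \<Rightarrow> ell2 \<Rightarrow> ell2" where
  "rank_one v x = cscale (- \<i> * cinner x v) v"

lemma cscale_cscale: "cscale k (cscale l x) = cscale (k * l) x"
  by (rule ell2_eqI) (simp add: coord_cscale)

lemma bounded_linear_cinner_left: "bounded_linear (\<lambda>x. cinner x v)"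
proof (rule bounded_linear_intro[where K = "2 * norm v"])
  show "cinner (r *\<^sub>R x) v = r *\<^sub>R cinner x v" for r x
    using cinner_cscale_left[of "of_real r" x v] by (simp add: cscale_of_real scaleR_conv_of_real)
  show "cmod (cinner x v) \<le> norm x * (2 * norm v)" for x
  proof -
    have "cmod (cinner x v) \<le> \<bar>x \<bullet> v\<bar> + \<bar>cscale \<i> x \<bullet> v\<bar>"
      using cmod_le[of "cinner x v"] by (simp add: cinner_via_inner)
    also have "\<dots> \<le> norm x * norm v + norm (cscale \<i> x) * norm v"
      by (intro add_mono Cauchy_Schwarz_ineq2)
    finally show ?thesis by (simp add: norm_cscale mult_ac)
  qed
qed (rule cinner_add_left)

text \<open>
  For the rank one operator \<open>B = - \<i> \<langle>\<cdot>, v\<rangle> v\<close> with a unit vector \<open>v\<close> the exponentials are explicit: \<open>B\<close>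
  acts as multiplication by \<open>- \<i>\<close> on \<open>v\<close> and vanishes on the orthogonal complement of \<open>v\<close>.
\<close>

locale rank_one_control =
  fixes a :: "nat \<Rightarrow> real" and v :: ell2
  assumes norm_v: "norm v = 1"
begin

sublocale diagonal_skew_perturbation a "rank_one v"
proof (rule diagonal_skew_perturbation.intro)
  show "bounded_linear (rank_one v)"
    unfolding rank_one_def[abs_def]
    by (intro bounded_linear_compose[OF bounded_linear_cscale_left]
        bounded_linear_const_mult bounded_linear_cinner_left)
  show "rank_one v (cscale c x) = cscale c (rank_one v x)" for c x
    by (simp add: rank_one_def cinner_cscale_left cscale_cscale mult_ac)
  show "rank_one v x \<bullet> y = - (x \<bullet> rank_one v y)" for x y
  proof -
    have "cinner x (rank_one v y) = cnj (- \<i> * cinner y v * cinner v x)"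
      by (subst cinner_commute) (simp add: rank_one_def cinner_cscale_left)
    then have "cinner (rank_one v x) y = - cinner x (rank_one v y)"
      by (simp add: rank_one_def cinner_cscale_left cinner_commute[of v y] cinner_commute[of v x])
    then show ?thesis by (simp add: inner_ell2_def)
  qed
qed

text \<open>
  This is \<open>exp (s B) x\<close>, the effect of an impulse of strength \<open>s\<close>.
\<close>

definition kick :: "real \<Rightarrow> ell2 \<Rightarrow> ell2" where
  "kick s x = x + cscale ((cis (- s) - 1) * cinner x v) v"

lemma cinner_v: "cinner v v = 1"
  using norm_v cinner_commute[of v v]
  by (simp add: complex_eq_iff norm_eq_sqrt_inner inner_ell2_def)

lemma rank_one_kick: "rank_one v (kick s x) = cscale (- \<i> * cis (- s) * cinner x v) v"
proof -
  have "cinner (kick s x) v = cis (- s) * cinner x v"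
    by (simp add: kick_def cinner_add_left cinner_cscale_left cinner_v left_diff_distrib)
  then show ?thesis by (simp add: rank_one_def mult.assoc)
qed

lemma kick_derivative:
  "((\<lambda>t. kick (c * t) x) has_vector_derivative c *\<^sub>R rank_one v (kick (c * t) x)) (at t)"
proof -
  have "((\<lambda>t. (cis (- (c * t)) - 1) * cinner x v) has_vector_derivative
      c *\<^sub>R (- \<i> * cis (- (c * t)) * cinner x v)) (at t)"
    unfolding has_vector_derivative_def
    by (auto intro!: derivative_eq_intros simp: scaleR_conv_of_real algebra_simps)
  from bounded_linear.has_vector_derivative[OF bounded_linear_cscale_left[of v] this]
  have "((\<lambda>t. cscale ((cis (- (c * t)) - 1) * cinner x v) v) has_vector_derivative
      c *\<^sub>R rank_one v (kick (c * t) x)) (at t)"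
    by (simp only: rank_one_kick linear_scale[OF bounded_linear.linear[OF bounded_linear_cscale_left]])
  then show ?thesis
    unfolding kick_def[of "c * _"] by (auto intro!: derivative_eq_intros)
qed

lemma norm_kick_le: "norm (kick s x) \<le> norm x + 2 * cmod (cinner x v)"
proof -
  have "cmod (cis (- s) - 1) \<le> 2"
    using norm_triangle_ineq4[of "cis (- s)" 1] by simp
  then have "norm (cscale ((cis (- s) - 1) * cinner x v) v) \<le> 2 * cmod (cinner x v)"
    by (simp add: norm_cscale norm_v norm_mult mult_right_mono)
  then show ?thesis
    unfolding kick_def by (intro norm_triangle_le) simp
qed

text \<open>
  The difference \<open>z\<close> of the two trajectories satisfies \<open>z' = A \<psi> + c B z\<close>. The large term \<open>c B z\<close> is
  orthogonal to \<open>z\<close> in the real inner product, so the distance grows at a rate controlled by the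
  energy alone, uniformly in \<open>c\<close>.
\<close>

lemma flow_near_kick:
  assumes x: "coord x \<in> energy_domain a" and T: "0 \<le> T"
    and M: "\<And>t. t \<in> {0..T} \<Longrightarrow> hnorm ell2_space (diag_generator a (coord (flow c t x))) \<le> M"
  shows "(norm (flow c T x - kick (c * T) x))\<^sup>2 \<le> 4 * (norm x + cmod (cinner x v)) * M * T"
proof -
  let ?z = "\<lambda>t. flow c t x - kick (c * t) x"
  let ?K = "4 * (norm x + cmod (cinner x v)) * M"
  have der: "\<exists>y. ((\<lambda>t. (norm (?z t))\<^sup>2 - ?K * t) has_real_derivative y) (at t) \<and> y \<le> 0"
    if t: "0 \<le> t" "t \<le> T" for t
  proof -
    obtain y where y: "coord y = diag_generator a (coord (flow c t x))"
      and fl: "((\<lambda>t. flow c t x) has_vector_derivative y + c *\<^sub>R rank_one v (flow c t x)) (at t)"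
      using flow_energy_domain[OF x, of c t] by metis
    let ?z' = "y + c *\<^sub>R rank_one v (?z t)"
    have "(?z has_vector_derivative
        (y + c *\<^sub>R rank_one v (flow c t x)) - c *\<^sub>R rank_one v (kick (c * t) x)) (at t)"
      by (intro derivative_intros fl kick_derivative)
    then have z: "(?z has_vector_derivative ?z') (at t)"
      by (simp add: linear_diff[OF bounded_linear.linear[OF bounded_linear_B]] scaleR_diff_right add_diff_eq)
    have "rank_one v (?z t) \<bullet> ?z t = 0"
      using skew_B[of "?z t" "?z t"] by (simp add: inner_commute)
    then have "?z t \<bullet> ?z' + ?z' \<bullet> ?z t = 2 * (?z t \<bullet> y)"
      by (simp add: inner_add_left inner_add_right inner_commute)
    then have "((\<lambda>t. (norm (?z t))\<^sup>2) has_real_derivative 2 * (?z t \<bullet> y)) (at t)"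
      using bounded_bilinear.has_vector_derivative[OF bounded_bilinear_inner z z]
      by (simp add: power2_norm_eq_inner has_real_derivative_iff_has_vector_derivative)
    then have "((\<lambda>t. (norm (?z t))\<^sup>2 - ?K * t) has_real_derivative 2 * (?z t \<bullet> y) - ?K) (at t)"
      by (rule DERIV_diff[OF _ DERIV_cmult_Id])
    moreover have "2 * (?z t \<bullet> y) - ?K \<le> 0"
    proof -
      have "?z t \<bullet> y \<le> norm (?z t) * norm y" by (rule norm_cauchy_schwarz)
      also have "\<dots> \<le> (norm x + (norm x + 2 * cmod (cinner x v))) * M"
      proof (rule mult_mono)
        show "norm (?z t) \<le> norm x + (norm x + 2 * cmod (cinner x v))"
          using norm_triangle_ineq4[of "flow c t x" "kick (c * t) x"] norm_kick_le[of "c * t" x]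
          by (simp add: norm_flow)
        show "norm y \<le> M" using M[of t] t by (simp add: y[symmetric] hnorm_coord)
      qed auto
      finally show ?thesis by (simp add: algebra_simps)
    qed
    ultimately show ?thesis by blast
  qed
  have "(norm (?z T))\<^sup>2 - ?K * T \<le> (norm (?z 0))\<^sup>2 - ?K * 0"
    using der by (rule DERIV_nonpos_imp_nonincreasing[OF T])
  moreover have "?z 0 = 0"
    by (rule ell2_eqI) (simp add: flow_0 kick_def coord_simps coord_cscale)
  ultimately show ?thesis by simp
qed

text \<open>
  Along the control \<open>c\<close> acting for the time \<open>s / c\<close>, with \<open>c \<rightarrow> \<infinity>\<close>, the states converge to \<open>kick s x\<close> as
  long as their energies stay bounded. The bound then passes to the limit in every coordinate; this
  is the closedness of \<open>A\<close>, tested on single coordinates.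
\<close>

lemma energy_bound_transfers_to_kick:
  assumes x: "coord x \<in> energy_domain a" and s: "0 \<le> s"
    and M: "\<And>c t. c > 0 \<Longrightarrow> 0 \<le> t \<Longrightarrow> hnorm ell2_space (diag_generator a (coord (flow c t x))) \<le> M"
  shows "\<bar>a j\<bar> * cmod (coord (kick s x) j) \<le> M"
proof -
  let ?K = "4 * (norm x + cmod (cinner x v)) * M * s"
  have bound: "\<bar>a j\<bar> * cmod (coord (kick s x) j) \<le> M + \<bar>a j\<bar> * sqrt (?K / c)" if c: "c > 0" for c
  proof -
    let ?f = "flow c (s / c) x"
    obtain y where y: "coord y = diag_generator a (coord ?f)"
      using flow_energy_domain[OF x, of c "s / c"] by metis
    have "\<bar>a j\<bar> * cmod (coord ?f j) = cmod (coord y j)"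
      by (simp add: y diag_generator_def norm_mult)
    also have "\<dots> \<le> norm y" by (rule norm_coord_le)
    also have "\<dots> \<le> M" using M[OF c, of "s / c"] c s by (simp add: y[symmetric] hnorm_coord)
    finally have 1: "\<bar>a j\<bar> * cmod (coord ?f j) \<le> M" .
    have "(norm (?f - kick (c * (s / c)) x))\<^sup>2 \<le> 4 * (norm x + cmod (cinner x v)) * M * (s / c)"
      using c s M by (intro flow_near_kick x) auto
    then have "norm (?f - kick s x) \<le> sqrt (?K / c)"
      using c by (simp add: real_le_rsqrt)
    then have "cmod (coord ?f j - coord (kick s x) j) \<le> sqrt (?K / c)"
      using norm_coord_le[of "?f - kick s x" j] by (simp add: coord_diff)
    then have "cmod (coord (kick s x) j) \<le> cmod (coord ?f j) + sqrt (?K / c)"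
      using norm_triangle_sub[of "coord (kick s x) j" "coord ?f j"] by (simp add: norm_minus_commute)
    then have "\<bar>a j\<bar> * cmod (coord (kick s x) j) \<le> \<bar>a j\<bar> * (cmod (coord ?f j) + sqrt (?K / c))"
      by (rule mult_left_mono) simp
    then show ?thesis using 1 by (simp add: distrib_left)
  qed
  have "((\<lambda>c. ?K / c) \<longlongrightarrow> 0) at_top"
    by (rule tendsto_divide_0[OF tendsto_const filterlim_at_top_imp_at_infinity[OF filterlim_ident]])
  from tendsto_real_sqrt[OF this] have lim: "((\<lambda>c. sqrt (?K / c)) \<longlongrightarrow> 0) at_top"
    unfolding real_sqrt_zero .
  have "((\<lambda>c. M + \<bar>a j\<bar> * sqrt (?K / c)) \<longlongrightarrow> M + \<bar>a j\<bar> * 0) at_top"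
    by (rule tendsto_add[OF tendsto_const tendsto_mult[OF tendsto_const lim]])
  then have "((\<lambda>c. M + \<bar>a j\<bar> * sqrt (?K / c)) \<longlongrightarrow> M) at_top" by simp
  then show ?thesis
  proof (rule tendsto_lowerbound)
    show "\<forall>\<^sub>F c in at_top. \<bar>a j\<bar> * cmod (coord (kick s x) j) \<le> M + \<bar>a j\<bar> * sqrt (?K / c)"
      using eventually_gt_at_top[of 0] by eventually_elim (rule bound)
  qed simp
qed

end

text \<open>
  The square moduli of the coordinates are \<open>1 / 2, 1 / 4, \<dots>\<close> with sum \<open>1\<close>, while the eigenvalues
  \<open>2 ^ j\<close> grow too fast for the vector to be in the domain of the generator.
\<close>

definition example_vector :: ell2 where
  "example_vector = ell2_of (\<lambda>j. complex_of_real (sqrt (1 / 2) ^ Suc j))"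

lemma coord_example_vector: "coord example_vector j = complex_of_real (sqrt (1 / 2) ^ Suc j)"
  and norm_example_vector: "norm example_vector = 1"
proof -
  have eq: "(cmod (complex_of_real (sqrt (1 / 2) ^ Suc j)))\<^sup>2 = (1 / 2) ^ Suc j" for j
  proof -
    have "(cmod (complex_of_real (sqrt (1 / 2) ^ Suc j)))\<^sup>2 = ((sqrt (1 / 2))\<^sup>2) ^ Suc j"
      unfolding norm_of_real power2_abs by (simp only: power_mult[symmetric] mult.commute)
    then show ?thesis by simp
  qed
  have sums: "(\<lambda>j. (1 / 2 :: real) ^ Suc j) sums 1" by (rule power_half_series)
  show coord: "coord example_vector j = complex_of_real (sqrt (1 / 2) ^ Suc j)" for j
    unfolding example_vector_def
    by (subst coord_ell2_of) (use sums_summable[OF sums] in \<open>simp_all only: eq\<close>)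
  have "(norm example_vector)\<^sup>2 = 1"
    using sums_unique2[OF sums_norm_ell2[of example_vector, unfolded coord eq] sums] .
  then show "norm example_vector = 1"
    using norm_ge_zero[of example_vector] by (auto simp: power2_eq_1_iff simp del: norm_ge_zero)
qed

interpretation example: rank_one_control "\<lambda>j. 2 ^ j" example_vector
  by unfold_locales (rule norm_example_vector)

text \<open>
  At strength \<open>\<pi>\<close> the kick is the reflection \<open>x - 2 \<langle>x, v\<rangle> v\<close>, whose second term leaves the domain.
  Even coordinates avoid half-integer powers of \<open>2\<close>.
\<close>

lemma example_kick_energy: "\<exists>j. M < \<bar>2 ^ j\<bar> * cmod (coord (example.kick pi (unit_vector 0)) j)"
proof -
  obtain m where m: "M < 2 ^ m" using real_arch_pow[of 2 M] by auto
  let ?j = "2 * Suc m" and ?r = "sqrt (1 / 2)"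
  have "coord (example.kick pi (unit_vector 0)) ?j = - 2 * complex_of_real (?r * ?r ^ Suc ?j)"
  proof -
    have "cis (- pi) = - 1" by (simp add: complex_eq_iff)
    then show ?thesis
      by (simp add: example.kick_def coord_add coord_cscale coord_unit_vector cinner_unit_vector
          coord_example_vector)
  qed
  also have "?r * ?r ^ Suc ?j = (?r\<^sup>2) ^ Suc (Suc m)"
    unfolding power_mult[symmetric] by (simp add: power_add[symmetric])
  also have "\<dots> = (1 / 2) ^ Suc (Suc m)" by simp
  finally have "\<bar>2 ^ ?j\<bar> * cmod (coord (example.kick pi (unit_vector 0)) ?j)
      = 2 ^ ?j * (2 * (1 / 2) ^ Suc (Suc m))"
    by (simp add: norm_mult norm_power norm_divide)
  also have "\<dots> = 2 ^ Suc m"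
    by (simp add: power_mult power_one_over field_simps power2_eq_square flip: power_mult_distrib)
  finally have "\<bar>2 ^ ?j\<bar> * cmod (coord (example.kick pi (unit_vector 0)) ?j) = 2 ^ Suc m" .
  moreover have "(2::real) ^ m \<le> 2 ^ Suc m" by simp
  ultimately show ?thesis using m by (metis order_less_le_trans)
qed

theorem proposition2:
  shows "\<exists>(H :: (nat \<Rightarrow> complex) cspace) D A B (\<phi> :: nat \<Rightarrow> nat \<Rightarrow> complex).
    separable_hilbert_space H \<and>
    skew_adjoint H D A \<and>
    positive_operator H D (\<lambda>\<psi>. hscale H \<i> (A \<psi>)) \<and>
    skew_symmetric H (hcarrier H) B \<and> bounded_operator H B \<and>
    (\<exists>a b :: real. \<forall>\<psi>\<in>D. hnorm H (B \<psi>) \<le> a * hnorm H (A \<psi>) + b * hnorm H \<psi>) \<and>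
    hilbert_basis H {1..} \<phi> \<and>
    (\<forall>j\<ge>1. \<phi> j \<in> D \<and> (\<exists>l :: real. A (\<phi> j) = hscale H (- \<i> * complex_of_real l) (\<phi> j))) \<and>
    (\<forall>M :: real. M \<ge> 0 \<longrightarrow>
      (\<exists>T u \<Upsilon>. T \<ge> 0 \<and> bounded_variation T u \<and> is_propagator H D A B T u \<Upsilon> \<and>
         hnorm H (A (\<Upsilon> T (\<phi> 1))) \<ge> M \<and>
         M \<ge> operator_norm H B / 4 * total_variation T u))"
proof (intro exI conjI)
  let ?a = "\<lambda>j. 2 ^ j :: real" and ?B = "on_coords (rank_one example_vector)"
    and ?\<phi> = "\<lambda>n. coord (unit_vector (n - 1))"
  show "separable_hilbert_space ell2_space" by (rule separable_hilbert_space_ell2)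
  show "skew_adjoint ell2_space (energy_domain ?a) (diag_generator ?a)"
    by (rule skew_adjoint_diag_generator)
  show "positive_operator ell2_space (energy_domain ?a) (\<lambda>\<psi>. hscale ell2_space \<i> (diag_generator ?a \<psi>))"
    by (rule positive_operator_diag_generator) simp
  show "skew_symmetric ell2_space (hcarrier ell2_space) ?B"
    by (rule example.skew_symmetric_on_coords)
  show "bounded_operator ell2_space ?B" by (rule example.bounded_operator_on_coords)
  show "\<forall>\<psi>\<in>energy_domain ?a. hnorm ell2_space (?B \<psi>)
      \<le> 0 * hnorm ell2_space (diag_generator ?a \<psi>) + onorm (rank_one example_vector) * hnorm ell2_space \<psi>"
    using example.hnorm_on_coords_le by (simp add: energy_domain_def)
  show "hilbert_basis ell2_space {1..} ?\<phi>" by (rule hilbert_basis_unit_vectors)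
  have "diag_generator ?a (?\<phi> j) = hscale ell2_space (- \<i> * complex_of_real (2 ^ (j - 1))) (?\<phi> j)" for j :: nat
    by (auto simp: diag_generator_def ell2_space_def coord_unit_vector)
  then show "\<forall>j\<ge>1. ?\<phi> j \<in> energy_domain ?a \<and>
      (\<exists>l::real. diag_generator ?a (?\<phi> j) = hscale ell2_space (- \<i> * complex_of_real l) (?\<phi> j))"
    using unit_vector_in_energy_domain by blast
  show "\<forall>M::real. M \<ge> 0 \<longrightarrow>
      (\<exists>T u \<Upsilon>. T \<ge> 0 \<and> bounded_variation T u \<and>
         is_propagator ell2_space (energy_domain ?a) (diag_generator ?a) ?B T u \<Upsilon> \<and>
         hnorm ell2_space (diag_generator ?a (\<Upsilon> T (?\<phi> 1))) \<ge> M \<and>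
         M \<ge> operator_norm ell2_space ?B / 4 * total_variation T u)"
  proof (intro allI impI)
    fix M :: real assume M: "0 \<le> M"
    obtain c t where t: "0 \<le> t"
      and energy: "M \<le> hnorm ell2_space (diag_generator ?a (coord (example.flow c t (unit_vector 0))))"
    proof -
      obtain j where "M < \<bar>2 ^ j\<bar> * cmod (coord (example.kick pi (unit_vector 0)) j)"
        using example_kick_energy by blast
      then show thesis
        using example.energy_bound_transfers_to_kick[OF unit_vector_in_energy_domain, of pi 0 M j]
          that by (metis less_eq_real_def linorder_not_le pi_ge_zero)
    qed
    have variation: "variation_sums t (\<lambda>_. c) = {0}" using t by (rule variation_sums_const)
    show "\<exists>T u \<Upsilon>. T \<ge> 0 \<and> bounded_variation T u \<and>
         is_propagator ell2_space (energy_domain ?a) (diag_generator ?a) ?B T u \<Upsilon> \<and>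
         hnorm ell2_space (diag_generator ?a (\<Upsilon> T (?\<phi> 1))) \<ge> M \<and>
         M \<ge> operator_norm ell2_space ?B / 4 * total_variation T u"
    proof (intro exI conjI)
      show "0 \<le> t" by (rule t)
      show "bounded_variation t (\<lambda>_. c)" by (simp add: bounded_variation_def variation)
      show "is_propagator ell2_space (energy_domain ?a) (diag_generator ?a) ?B t (\<lambda>_. c)
          (\<lambda>t. on_coords (example.flow c t))"
        using t by (rule example.is_propagator_flow)
      show "M \<le> hnorm ell2_space (diag_generator ?a (on_coords (example.flow c t) (?\<phi> 1)))"
        using energy by simp
      show "operator_norm ell2_space ?B / 4 * total_variation t (\<lambda>_. c) \<le> M"
        using M by (simp add: total_variation_def variation)
    qed
  qed
qed

end
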